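(* Let $B\subset\mathbf{R}^2$ be a Borel region and $\rho:B\to[0,\infty)$ a measurable function, constant in time, with $0<\int_B\rho(x)\,dx<\infty$, and let $\nu>0$. Suppose users demand service in $B$ in such a way that: (1) the positions of the users are independent and identically distributed; (2) the time between two consecutive demands is exponentially distributed, where $\rho$ is the surface density of the arrival rate, i.e. the arrival rate in each Borel region $H\subseteq B$ is $h=\int_H\rho(x)\,dx$; (3) the service time of every user is exponentially distributed with mean $1/\nu$. Then, in equilibrium, the point process $\Phi$ of the positions of the active users is a Poisson process on $B$ with intensity measure $d\Lambda(x)=\rho(x)\nu^{-1}\,dx$.
   Context: Precise model. Put $\lambda=\int_B\rho(x)\,dx$. Demands arrive at the points $T_n$ of a homogeneous Poisson process of rate $\lambda$ on the time axis (independent exponential interarrival times of mean $1/\lambda$); the $n$-th user has a position $X_n\in B$ with density $\rho/\lambda$ and a service time $S_n$, exponential with mean $1/\nu$. The sequences $(X_n)$ and $(S_n)$ are each i.i.d., and the arrival process, positions and service times are mutually independent. No user is ever blocked, and a user's position does not change during service. User $n$ is active at time $t$ if $T_n\le t<T_n+S_n$. "In equilibrium" refers to the stationary regime, i.e. arrivals take place over the whole time axis $(-\infty,\infty)$ and the set $\Phi$ of positions of the users active at a given fixed time $t$ is considered. A point process $\Phi$ (a random locally finite set of points) is a Poisson process of intensity $\Lambda$, for a $\sigma$-finite measure $\Lambda$, if, with $\Phi_A$ denoting the number of points of $\Phi$ in $A$: (i) for any compact $A$, $\Phi_A$ is a Poisson random variable of parameter $\Lambda(A)$; (ii) for any disjoint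 (Borel) sets $A$ and $A'$, the random variables $\Phi_A$ and $\Phi_{A'}$ are independent. *)

theory Defs
  imports "HOL-Probability.Probability"
begin

text \<open>
  Extended-valued, since for a general \<open>\<sigma>\<close>-finite intensity a non-compact set may contain infinitely
  many points.
\<close>

definition point_count :: "'a set \<Rightarrow> 'a set \<Rightarrow> ennreal" where
  "point_count P A = emeasure (count_space UNIV) (P \<inter> A)"

text \<open>
  The Poisson probabilities are written out because \<^const>\<open>poisson_pmf\<close> is only specified for a
  positive parameter, whereas \<open>\<Lambda> A = 0\<close> is allowed here. Finiteness of \<open>\<Lambda> A\<close> for compact \<open>A\<close>, implicit
  in speaking of a Poisson variable with parameter \<open>\<Lambda> A\<close>, is required explicitly, since
  \<^const>\<open>measure\<close> maps infinite values to 0.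
  The process lives in the region \<open>B\<close>; \<open>\<Lambda>\<close> is a measure on the whole ambient space, and the defining
  conditions are imposed for all compact (disjoint Borel) subsets of that space, not just for those
  inside \<open>B\<close>.
\<close>

definition poisson_process_on ::
    "'w measure \<Rightarrow> 'a::euclidean_space set \<Rightarrow> 'a measure \<Rightarrow> ('w \<Rightarrow> 'a set) \<Rightarrow> bool" where
  "poisson_process_on M B \<Lambda> \<Phi> \<longleftrightarrow>
     prob_space M \<and> sets \<Lambda> = sets borel \<and> sigma_finite_measure \<Lambda> \<and>
     (\<forall>A\<in>sets borel. (\<lambda>\<omega>. point_count (\<Phi> \<omega>) A) \<in> borel_measurable M) \<and>
     (AE \<omega> in M. \<Phi> \<omega> \<subseteq> B \<and> (\<forall>K. compact K \<longrightarrow> finite (\<Phi> \<omega> \<inter> K))) \<and>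
     (\<forall>A. compact A \<longrightarrow> emeasure \<Lambda> A < \<infinity> \<and>
        (\<forall>k::nat. measure M {\<omega>\<in>space M. point_count (\<Phi> \<omega>) A = of_nat k} =
           measure \<Lambda> A ^ k / fact k * exp (- measure \<Lambda> A))) \<and>
     (\<forall>A\<in>sets borel. \<forall>A'\<in>sets borel. A \<inter> A' = {} \<longrightarrow>
        prob_space.indep_var M borel (\<lambda>\<omega>. point_count (\<Phi> \<omega>) A)
                               borel (\<lambda>\<omega>. point_count (\<Phi> \<omega>) A'))"

text \<open>
  The homogeneous Poisson process on the whole time axis, enumerated in the usual way as
  \<open>\<dots> < T (-1) < T 0 < 0 < T 1 < T 2 < \<dots>\<close> almost surely. The waiting times \<open>T 1\<close> and \<open>- T 0\<close> from the
  origin to the next and to the previous point, and the interarrival times on either side, are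
  independent exponential variables. (The interval \<open>T 1 - T 0\<close> straddling the fixed time 0 is
  size-biased, i.e. the sum of two of them; requiring it to be exponential would
  make the process non-stationary.)
\<close>

definition interarrival :: "(int \<Rightarrow> 'w \<Rightarrow> real) \<Rightarrow> int \<Rightarrow> 'w \<Rightarrow> real" where
  "interarrival T n \<omega> =
     (if n \<ge> 2 then T n \<omega> - T (n - 1) \<omega>
      else if n = 1 then T 1 \<omega>
      else if n = 0 then - T 0 \<omega>
      else T (n + 1) \<omega> - T n \<omega>)"

definition homogeneous_poisson_arrivals ::
    "'w measure \<Rightarrow> real \<Rightarrow> (int \<Rightarrow> 'w \<Rightarrow> real) \<Rightarrow> bool" where
  "homogeneous_poisson_arrivals M r T \<longleftrightarrow>
     prob_space.indep_vars M (\<lambda>_. borel) (interarrival T) UNIV \<and>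
     (\<forall>n. distributed M lborel (interarrival T n) (exponential_density r))"

definition iid_with_density ::
    "'w measure \<Rightarrow> ('a::euclidean_space \<Rightarrow> real) \<Rightarrow> (int \<Rightarrow> 'w \<Rightarrow> 'a) \<Rightarrow> bool" where
  "iid_with_density M f X \<longleftrightarrow>
     prob_space.indep_vars M (\<lambda>_. borel) X UNIV \<and> (\<forall>n. distributed M lborel (X n) f)"

text \<open>
  The library's \<^const>\<open>prob_space.indep_vars\<close> needs a common codomain, so mutual independence of the
  three families (as random elements of sequence space) is stated for the \<open>\<sigma>\<close>-algebras they generate.
  Measurability is included: \<^const>\<open>prob_space.indep_sets\<close> requires the generated sets to be events.
\<close>

definition mutually_indep_families ::
    "'w measure \<Rightarrow> (int \<Rightarrow> 'w \<Rightarrow> real) \<Rightarrow> (int \<Rightarrow> 'w \<Rightarrow> 'a::euclidean_space) \<Rightarrow>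
     (int \<Rightarrow> 'w \<Rightarrow> real) \<Rightarrow> bool" where
  "mutually_indep_families M T X S \<longleftrightarrow>
     prob_space.indep_sets M
       (\<lambda>i::nat.
          if i = 0 then sets (vimage_algebra (space M) (\<lambda>\<omega> n. T n \<omega>) (PiM UNIV (\<lambda>_. borel)))
          else if i = 1 then sets (vimage_algebra (space M) (\<lambda>\<omega> n. X n \<omega>) (PiM UNIV (\<lambda>_. borel)))
          else sets (vimage_algebra (space M) (\<lambda>\<omega> n. S n \<omega>) (PiM UNIV (\<lambda>_. borel))))
       {0, 1, 2}"

definition active_positions ::
    "(int \<Rightarrow> 'w \<Rightarrow> real) \<Rightarrow> (int \<Rightarrow> 'w \<Rightarrow> 'a) \<Rightarrow> (int \<Rightarrow> 'w \<Rightarrow> real) \<Rightarrow> real \<Rightarrow> 'w \<Rightarrow> 'a set" where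
  "active_positions T X S t \<omega> = {X n \<omega> | n. T n \<omega> \<le> t \<and> t < T n \<omega> + S n \<omega>}"

end

theory Submission
  imports Defs "HOL-Complex_Analysis.Cauchy_Integral_Formula"
begin

text \<open>
  The joint probability generating function of the numbers \<open>N\<close>, \<open>N'\<close> of active users in two disjoint sets
  is computed. Integrating out positions and service times leaves the expectation of
  \<open>\<Prod>n. h (T n)\<close> with \<open>h s = 1 - c exp (- \<nu> (t - s))\<close> for \<open>s \<le> t\<close> and \<open>h s = 1\<close> otherwise. On either side of the
  origin the arrivals form a random walk \<open>V\<close> with exponential steps; if \<open>G' = \<lambda> (1 - h) G\<close> and \<open>G \<longlonglongrightarrow> 1\<close> at infinity,
  then \<open>\<Prod>k<n. h (V (k + 1))\<close> times \<open>G (V n)\<close> is a martingale, so the infinite product has expectation \<open>G 0\<close>.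
  The two sides multiply to \<open>exp (- \<lambda> c / \<nu>)\<close> whatever \<open>t\<close> is, and since \<open>c\<close> is affine in the two arguments
  of the generating function, this is the product of two Poisson generating functions.
  Comparing power series coefficients gives the Poisson laws and the independence.
\<close>

section \<open>Integrating functions of independent random variables\<close>

text \<open>Unlike \<^const>\<open>prob_space.indep_var\<close>, this allows \<open>Y\<close> and \<open>Z\<close> to take values in different types.\<close>

lemma (in prob_space) indep_set_nn_integral:
  assumes ind: "indep_set {Y -` a \<inter> space M |a. a \<in> sets A} {Z -` b \<inter> space M |b. b \<in> sets B}"
    and [measurable]: "Y \<in> M \<rightarrow>\<^sub>M A" "Z \<in> M \<rightarrow>\<^sub>M B" "f \<in> borel_measurable (A \<Otimes>\<^sub>M B)"
  shows "(\<integral>\<^sup>+\<omega>. f (Y \<omega>, Z \<omega>) \<partial>M) = (\<integral>\<^sup>+\<omega>. \<integral>\<^sup>+\<omega>'. f (Y \<omega>, Z \<omega>') \<partial>M \<partial>M)"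
proof -
  interpret Y: prob_space "distr M A Y"
    by (rule prob_space_distr) simp
  interpret Z: prob_space "distr M B Z"
    by (rule prob_space_distr) simp
  have eq: "distr M A Y \<Otimes>\<^sub>M distr M B Z = distr M (A \<Otimes>\<^sub>M B) (\<lambda>\<omega>. (Y \<omega>, Z \<omega>))"
  proof (rule pair_measure_eqI)
    fix a b assume "a \<in> sets (distr M A Y)" "b \<in> sets (distr M B Z)"
    then have [measurable]: "a \<in> sets A" "b \<in> sets B" by simp_all
    have "(\<lambda>\<omega>. (Y \<omega>, Z \<omega>)) -` (a \<times> b) \<inter> space M = (Y -` a \<inter> space M) \<inter> (Z -` b \<inter> space M)"
      by auto
    moreover have "prob ((Y -` a \<inter> space M) \<inter> (Z -` b \<inter> space M)) = prob (Y -` a \<inter> space M) * prob (Z -` b \<inter> space M)"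
      using \<open>a \<in> sets A\<close> \<open>b \<in> sets B\<close> by (intro indep_setD[OF ind]) auto
    ultimately show "emeasure (distr M A Y) a * emeasure (distr M B Z) b =
        emeasure (distr M (A \<Otimes>\<^sub>M B) (\<lambda>\<omega>. (Y \<omega>, Z \<omega>))) (a \<times> b)"
      by (simp add: emeasure_distr emeasure_eq_measure ennreal_mult)
  qed (auto intro: Y.sigma_finite_measure Z.sigma_finite_measure)
  have "(\<integral>\<^sup>+\<omega>. f (Y \<omega>, Z \<omega>) \<partial>M) = (\<integral>\<^sup>+p. f p \<partial>(distr M A Y \<Otimes>\<^sub>M distr M B Z))"
    unfolding eq by (simp add: nn_integral_distr)
  also have "\<dots> = (\<integral>\<^sup>+y. \<integral>\<^sup>+z. f (y, z) \<partial>distr M B Z \<partial>distr M A Y)"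
    by (rule Z.nn_integral_fst[symmetric]) measurable
  also have "\<dots> = (\<integral>\<^sup>+\<omega>. \<integral>\<^sup>+\<omega>'. f (Y \<omega>, Z \<omega>') \<partial>M \<partial>M)"
    by (subst nn_integral_distr) (auto simp: nn_integral_distr intro!: nn_integral_cong)
  finally show ?thesis .
qed

lemma (in prob_space) indep_var_nn_integral:
  assumes ind: "indep_var A Y B Z" and f: "f \<in> borel_measurable (A \<Otimes>\<^sub>M B)"
  shows "(\<integral>\<^sup>+\<omega>. f (Y \<omega>, Z \<omega>) \<partial>M) = (\<integral>\<^sup>+\<omega>. \<integral>\<^sup>+\<omega>'. f (Y \<omega>, Z \<omega>') \<partial>M \<partial>M)"
proof (rule indep_set_nn_integral[OF _ _ _ f])
  show "indep_set {Y -` a \<inter> space M |a. a \<in> sets A} {Z -` b \<inter> space M |b. b \<in> sets B}"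
    using ind unfolding indep_var_eq indep_set_def
    by (elim conjE indep_sets_mono_sets) (auto split: bool.split)
qed (use ind in \<open>auto simp: indep_var_eq\<close>)

section \<open>Exponential averages through the fundamental theorem of calculus\<close>

text \<open>The fundamental theorem is applied on \<open>{a..a + real n}\<close>, and
  \<open>n\<close> goes to infinity by monotone convergence. The exceptional set \<open>S\<close>
  leaves room for a corner of \<open>F\<close>: the functions \<open>G\<close> used later may fail
  to be differentiable at one point.\<close>

lemma nn_integral_FTC_atLeast_strong:
  fixes F f :: "real \<Rightarrow> real"
  assumes [measurable]: "f \<in> borel_measurable borel"
    and "finite S" and cont: "continuous_on {a..} F"
    and deriv: "\<And>x. a < x \<Longrightarrow> x \<notin> S \<Longrightarrow> (F has_real_derivative f x) (at x)"
    and nonneg: "\<And>x. a \<le> x \<Longrightarrow> 0 \<le> f x"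
    and lim: "(F \<longlongrightarrow> L) at_top"
  shows "(\<integral>\<^sup>+x. ennreal (f x) * indicator {a..} x \<partial>lborel) = ennreal (L - F a)"
proof -
  let ?f = "\<lambda>(n::nat) x. ennreal (f x) * indicator {a..a + real n} x"
  have int: "(\<integral>\<^sup>+x. ?f n x \<partial>lborel) = ennreal (F (a + real n) - F a)" for n
  proof (rule nn_integral_has_integral_lebesgue')
    show "(f has_integral F (a + real n) - F a) {a..a + real n}"
      using \<open>finite S\<close> deriv
      by (intro fundamental_theorem_of_calculus_interior_strong[of S] continuous_on_subset[OF cont])
         (auto simp: has_real_derivative_iff_has_vector_derivative)
  qed (use nonneg in auto)
  have "(\<integral>\<^sup>+x. ennreal (f x) * indicator {a..} x \<partial>lborel) = (\<integral>\<^sup>+x. (SUP n. ?f n x) \<partial>lborel)"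
  proof (intro nn_integral_cong)
    fix x
    obtain n where n: "x - a \<le> real n"
      using real_arch_simple by blast
    show "ennreal (f x) * indicator {a..} x = (SUP n. ?f n x)"
    proof (rule antisym)
      show "ennreal (f x) * indicator {a..} x \<le> (SUP n. ?f n x)"
        by (rule SUP_upper2[of n]) (use n in \<open>auto simp: indicator_def\<close>)
      show "(SUP n. ?f n x) \<le> ennreal (f x) * indicator {a..} x"
        by (rule SUP_least) (auto simp: indicator_def)
    qed
  qed
  also have "\<dots> = (SUP n. \<integral>\<^sup>+x. ?f n x \<partial>lborel)"
    by (rule nn_integral_monotone_convergence_SUP)
       (auto simp: incseq_def le_fun_def indicator_def)
  also have "\<dots> = ennreal (L - F a)"
  proof (rule LIMSEQ_unique)
    have "incseq (\<lambda>n. \<integral>\<^sup>+x. ?f n x \<partial>lborel)"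
      by (auto simp: incseq_def indicator_def intro!: nn_integral_mono)
    then show "(\<lambda>n. \<integral>\<^sup>+x. ?f n x \<partial>lborel) \<longlonglongrightarrow> (SUP n. \<integral>\<^sup>+x. ?f n x \<partial>lborel)"
      by (rule LIMSEQ_SUP)
    have "filterlim (\<lambda>n. a + real n) at_top sequentially"
      by (rule filterlim_tendsto_add_at_top[OF tendsto_const filterlim_real_sequentially])
    from filterlim_compose[OF lim this]
    show "(\<lambda>n. \<integral>\<^sup>+x. ?f n x \<partial>lborel) \<longlonglongrightarrow> ennreal (L - F a)"
      unfolding int by (intro tendsto_ennrealI tendsto_diff tendsto_const)
  qed
  finally show ?thesis .
qed

text \<open>The integrated form of \<open>G' = l (1 - h) G\<close>, obtained by differentiating \<open>w \<mapsto> exp (- l w) G (v + w)\<close>.\<close>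

lemma nn_integral_exponential_renewal:
  fixes h G :: "real \<Rightarrow> real"
  assumes l: "0 < l" and [measurable]: "h \<in> borel_measurable borel"
    and h: "\<And>x. 0 \<le> h x" and G: "\<And>x. 0 \<le> G x"
    and "finite S" and cont: "continuous_on UNIV G"
    and deriv: "\<And>x. x \<notin> S \<Longrightarrow> (G has_real_derivative l * (1 - h x) * G x) (at x)"
    and lim: "(G \<longlongrightarrow> g) at_top"
  shows "(\<integral>\<^sup>+w. ennreal (exponential_density l w) * ennreal (h (v + w) * G (v + w)) \<partial>lborel) = ennreal (G v)"
proof -
  have [measurable]: "G \<in> borel_measurable borel"
    using cont by (rule borel_measurable_continuous_onI)
  let ?F = "\<lambda>w. - (exp (- l * w) * G (v + w))"
  have "(\<integral>\<^sup>+w. ennreal (exponential_density l w) * ennreal (h (v + w) * G (v + w)) \<partial>lborel)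
     = (\<integral>\<^sup>+w. ennreal (l * exp (- l * w) * (h (v + w) * G (v + w))) * indicator {0..} w \<partial>lborel)"
    using l h G
    by (intro nn_integral_cong)
       (auto simp: exponential_density_def indicator_def ennreal_mult'[symmetric] mult_ac)
  also have "\<dots> = ennreal (0 - ?F 0)"
  proof (rule nn_integral_FTC_atLeast_strong)
    show "finite ((\<lambda>s. s - v) ` S)"
      using \<open>finite S\<close> by simp
    show "continuous_on {0..} ?F"
      by (intro continuous_intros continuous_on_compose2[OF cont]) auto
    show "(?F has_real_derivative l * exp (- l * x) * (h (v + x) * G (v + x))) (at x)"
      if "x \<notin> (\<lambda>s. s - v) ` S" for x
    proof -
      have "v + x \<notin> S"
        using that by force
      from deriv[OF this] have d: "((\<lambda>w. G (v + w)) has_real_derivative l * (1 - h (v + x)) * G (v + x)) (at x)"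
        using DERIV_shift[of G _ x v] by (simp add: add.commute)
      show ?thesis
        by (rule derivative_eq_intros d refl | simp)+ (simp add: algebra_simps)
    qed
    have "filterlim (\<lambda>w. v + w) at_top at_top"
      by (rule filterlim_tendsto_add_at_top[OF tendsto_const filterlim_ident])
    from filterlim_compose[OF lim this] have G': "((\<lambda>w. G (v + w)) \<longlongrightarrow> g) at_top" .
    have "filterlim (\<lambda>w. - (l * w)) at_bot at_top"
      unfolding filterlim_uminus_at_bot
      using l by (auto intro!: filterlim_tendsto_pos_mult_at_top[OF tendsto_const _ filterlim_ident])
    then have "((\<lambda>w. exp (- (l * w))) \<longlongrightarrow> 0) at_top"
      by (rule filterlim_compose[OF exp_at_bot])
    from tendsto_minus[OF tendsto_mult[OF this G']]
    show "(?F \<longlongrightarrow> 0) at_top" by simp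
    show "0 \<le> l * exp (- l * x) * (h (v + x) * G (v + x))" for x
      using l h G by (intro mult_nonneg_nonneg) auto
  qed simp
  finally show ?thesis by simp
qed

section \<open>Random walks with exponential steps\<close>

definition walk :: "(nat \<Rightarrow> 'w \<Rightarrow> real) \<Rightarrow> nat \<Rightarrow> 'w \<Rightarrow> real" where
  "walk W n \<omega> = (\<Sum>k<n. W k \<omega>)"

lemma walk_simps [simp]: "walk W 0 \<omega> = 0" "walk W (Suc n) \<omega> = walk W n \<omega> + W n \<omega>"
  by (simp_all add: walk_def)

lemma measurable_walk [measurable (raw)]:
  "(\<And>n. W n \<in> borel_measurable M) \<Longrightarrow> walk W n \<in> borel_measurable M"
  unfolding walk_def[abs_def] by measurable

locale exponential_walk = prob_space +
  fixes W :: "nat \<Rightarrow> 'a \<Rightarrow> real" and l :: real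
  assumes l: "0 < l" and indep: "indep_vars (\<lambda>_. borel) W UNIV"
    and dist: "\<And>n. distributed M lborel (W n) (exponential_density l)"
begin

lemma measurable_step [measurable]: "W n \<in> borel_measurable M"
  using dist[of n] by (simp add: distributed_def)

text \<open>\<open>\<Prod>k<n. h (V (k + 1)) G (V n)\<close> is a martingale along the walk \<open>V\<close>.\<close>

lemma nn_integral_walk_prod:
  fixes h G :: "real \<Rightarrow> real"
  assumes [measurable]: "h \<in> borel_measurable borel"
    and h: "\<And>x. 0 \<le> h x" and G: "\<And>x. 0 \<le> G x"
    and "finite S" and cont: "continuous_on UNIV G"
    and deriv: "\<And>x. x \<notin> S \<Longrightarrow> (G has_real_derivative l * (1 - h x) * G x) (at x)"
    and lim: "(G \<longlongrightarrow> g) at_top"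
  shows "(\<integral>\<^sup>+\<omega>. (\<Prod>k<n. ennreal (h (walk W (Suc k) \<omega>))) * ennreal (G (walk W n \<omega>)) \<partial>M) = ennreal (G 0)"
proof (induction n)
  case 0
  then show ?case by (simp add: emeasure_space_1)
next
  case (Suc n)
  have [measurable]: "G \<in> borel_measurable borel"
    using cont by (rule borel_measurable_continuous_onI)
  let ?V = "\<lambda>(k::nat) (y::nat \<Rightarrow> real). \<Sum>i<k. y i"
  let ?P = "PiM {..<n} (\<lambda>_. borel :: real measure)"
  let ?Y = "\<lambda>\<omega>. \<lambda>k\<in>{..<n}. W k \<omega>"
  \<comment> \<open>\<open>y\<close> stands for the first \<open>n\<close> steps, \<open>z\<close>
    for the step of index \<open>n\<close>. Independence allows the latter to be averaged out with
    \<open>walk W n\<close> frozen.\<close>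
  let ?f = "\<lambda>(y, z). (\<Prod>k<n. ennreal (h (?V (Suc k) y))) * ennreal (h (?V n y + z n) * G (?V n y + z n))"
  let ?Q = "PiM {n} (\<lambda>_. borel :: real measure)"
  let ?Z = "\<lambda>\<omega>. \<lambda>k\<in>{n}. W k \<omega>"
  have ind: "indep_var ?P ?Y ?Q ?Z"
    by (rule indep_var_restrict[OF indep]) auto
  have V: "?V k (?Y \<omega>) = walk W k \<omega>" if "k \<le> n" for k \<omega>
    using that by (auto simp: walk_def intro!: sum.cong)
  have [measurable]: "?V k \<in> borel_measurable ?P" if "k \<le> n" for k
    using that by (intro borel_measurable_sum measurable_component_singleton) simp
  have [measurable]: "?f \<in> borel_measurable (?P \<Otimes>\<^sub>M ?Q)"
    unfolding split_beta' by measurable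
  have "(\<integral>\<^sup>+\<omega>. (\<Prod>k<Suc n. ennreal (h (walk W (Suc k) \<omega>))) * ennreal (G (walk W (Suc n) \<omega>)) \<partial>M)
    = (\<integral>\<^sup>+\<omega>. ?f (?Y \<omega>, ?Z \<omega>) \<partial>M)"
  proof (intro nn_integral_cong)
    fix \<omega>
    have "(\<Prod>k<n. ennreal (h (?V (Suc k) (?Y \<omega>)))) = (\<Prod>k<n. ennreal (h (walk W (Suc k) \<omega>)))"
      by (intro prod.cong refl) (simp only: V Suc_leI lessThan_iff)
    then show "(\<Prod>k<Suc n. ennreal (h (walk W (Suc k) \<omega>))) * ennreal (G (walk W (Suc n) \<omega>)) = ?f (?Y \<omega>, ?Z \<omega>)"
      using h G V[of n \<omega>] by (simp add: ennreal_mult mult.assoc del: sum.lessThan_Suc)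
  qed
  also have "\<dots> = (\<integral>\<^sup>+\<omega>. \<integral>\<^sup>+\<omega>'. ?f (?Y \<omega>, ?Z \<omega>') \<partial>M \<partial>M)"
    by (rule indep_var_nn_integral[OF ind]) measurable
  also have "\<dots> = (\<integral>\<^sup>+\<omega>. (\<Prod>k<n. ennreal (h (walk W (Suc k) \<omega>))) * ennreal (G (walk W n \<omega>)) \<partial>M)"
  proof (intro nn_integral_cong)
    fix \<omega>
    have p: "(\<Prod>k<n. ennreal (h (?V (Suc k) (?Y \<omega>)))) = (\<Prod>k<n. ennreal (h (walk W (Suc k) \<omega>)))"
      by (intro prod.cong refl) (simp only: V Suc_leI lessThan_iff)
    have "(\<integral>\<^sup>+\<omega>'. ?f (?Y \<omega>, ?Z \<omega>') \<partial>M)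
      = (\<Prod>k<n. ennreal (h (walk W (Suc k) \<omega>))) *
        (\<integral>\<^sup>+\<omega>'. ennreal (h (walk W n \<omega> + W n \<omega>') * G (walk W n \<omega> + W n \<omega>')) \<partial>M)"
      unfolding split p V[OF order_refl] by (simp add: nn_integral_cmult)
    also have "(\<integral>\<^sup>+\<omega>'. ennreal (h (walk W n \<omega> + W n \<omega>') * G (walk W n \<omega> + W n \<omega>')) \<partial>M)
      = (\<integral>\<^sup>+w. ennreal (exponential_density l w) * ennreal (h (walk W n \<omega> + w) * G (walk W n \<omega> + w)) \<partial>lborel)"
      by (rule distributed_nn_integral[OF dist, symmetric]) measurable
    \<comment> \<open>Averaging over the new step absorbs its factor \<open>h\<close> and moves
      \<open>G\<close> back to the previous position of the walk.\<close>
    also have "\<dots> = ennreal (G (walk W n \<omega>))"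
      using assms l by (intro nn_integral_exponential_renewal[where S=S and g=g]) auto
    finally show "(\<integral>\<^sup>+\<omega>'. ?f (?Y \<omega>, ?Z \<omega>') \<partial>M) =
      (\<Prod>k<n. ennreal (h (walk W (Suc k) \<omega>))) * ennreal (G (walk W n \<omega>))" .
  qed
  also note Suc
  finally show ?case .
qed

text \<open>The constant \<open>h = (l + \<nu>) / l\<close> makes \<open>exp (- \<nu> * x)\<close> a
  solution of the differential equation, so the martingale identity gives this Laplace transform up
  to the factor \<open>h ^ n\<close>.\<close>

lemma nn_integral_exp_walk:
  assumes "0 < \<nu>"
  shows "(\<integral>\<^sup>+\<omega>. ennreal (exp (- \<nu> * walk W n \<omega>)) \<partial>M) = ennreal ((l / (l + \<nu>)) ^ n)"
proof -
  let ?q = "l / (l + \<nu>)"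
  have q: "0 < ?q" using l assms by simp
  have lim: "((\<lambda>x. exp (- \<nu> * x)) \<longlongrightarrow> 0) at_top"
    using assms by (intro filterlim_compose[OF exp_at_bot])
      (auto simp: filterlim_uminus_at_bot intro!: filterlim_tendsto_pos_mult_at_top[OF tendsto_const _ filterlim_ident])
  have "(\<integral>\<^sup>+\<omega>. (\<Prod>k<n. ennreal (1 / ?q)) * ennreal (exp (- \<nu> * walk W n \<omega>)) \<partial>M) = ennreal (exp (- \<nu> * 0))"
  proof (rule nn_integral_walk_prod[where S="{}" and g=0])
    show "((\<lambda>x. exp (- \<nu> * x)) has_real_derivative l * (1 - 1 / ?q) * exp (- \<nu> * x)) (at x)" for x
      using l assms by (auto intro!: derivative_eq_intros simp: field_simps)
  qed (use q lim l assms in \<open>auto intro!: continuous_intros\<close>)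
  then have "ennreal ((1 / ?q) ^ n) * (\<integral>\<^sup>+\<omega>. ennreal (exp (- \<nu> * walk W n \<omega>)) \<partial>M) = 1"
    using q l assms by (simp add: nn_integral_cmult ennreal_power)
  then have "ennreal (?q ^ n) * (ennreal ((1 / ?q) ^ n) * (\<integral>\<^sup>+\<omega>. ennreal (exp (- \<nu> * walk W n \<omega>)) \<partial>M)) = ennreal (?q ^ n)"
    by simp
  moreover have "ennreal (?q ^ n) * ennreal ((1 / ?q) ^ n) = 1"
    using q l assms by (simp add: ennreal_mult[symmetric] power_mult_distrib[symmetric])
  ultimately show ?thesis
    by (simp add: mult.assoc[symmetric])
qed

text \<open>Let \<open>H\<close> be the product of the first \<open>n\<close> factors and
  \<open>V\<close> the walk. The martingale identity gives \<open>H * G (V n)\<close> the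
  expectation \<open>G 0\<close>. Since \<open>G \<le> 1\<close> and \<open>H \<le> 1\<close>,
  replacing it by \<open>H\<close> costs at most \<open>C\<close> times the expectation of
  \<open>exp (- \<nu> * V n)\<close>, which decays geometrically. The hypothesis
  \<open>bound\<close> yields both this error estimate and the limit 1 of \<open>G\<close>.\<close>

lemma walk_prod_tendsto:
  fixes h G :: "real \<Rightarrow> real"
  assumes [measurable]: "h \<in> borel_measurable borel"
    and h: "\<And>x. 0 \<le> h x" "\<And>x. h x \<le> 1" and G: "\<And>x. 0 \<le> G x" "\<And>x. G x \<le> 1"
    and "finite S" and cont: "continuous_on UNIV G"
    and deriv: "\<And>x. x \<notin> S \<Longrightarrow> (G has_real_derivative l * (1 - h x) * G x) (at x)"
    and "0 < \<nu>" and bound: "\<And>x. 1 - G x \<le> C * exp (- \<nu> * x)"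
  shows "(\<lambda>n. \<integral>\<^sup>+\<omega>. (\<Prod>k<n. ennreal (h (walk W (Suc k) \<omega>))) \<partial>M) \<longlonglongrightarrow> ennreal (G 0)"
proof -
  have [measurable]: "G \<in> borel_measurable borel"
    using cont by (rule borel_measurable_continuous_onI)
  have "0 \<le> C"
    using bound[of 0] G(2)[of 0] by simp
  have e: "((\<lambda>x. C * exp (- \<nu> * x)) \<longlongrightarrow> C * 0) at_top"
    using \<open>0 < \<nu>\<close> by (intro tendsto_intros filterlim_compose[OF exp_at_bot])
      (auto simp: filterlim_uminus_at_bot intro!: filterlim_tendsto_pos_mult_at_top[OF tendsto_const _ filterlim_ident])
  have "(G \<longlongrightarrow> 1) at_top"
  proof (rule tendsto_sandwich)
    show "((\<lambda>x. 1 - C * exp (- \<nu> * x)) \<longlongrightarrow> 1) at_top"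
      using tendsto_diff[OF tendsto_const e, of 1] by simp
    show "\<forall>\<^sub>F x in at_top. 1 - C * exp (- \<nu> * x) \<le> G x"
      using bound by (intro always_eventually allI) (simp add: algebra_simps)
  qed (use G in auto)
  note E = nn_integral_walk_prod[OF _ h(1) G(1) \<open>finite S\<close> cont deriv this, simplified]
  let ?H = "\<lambda>n \<omega>. \<Prod>k<n. ennreal (h (walk W (Suc k) \<omega>))"
  have H1: "?H n \<omega> \<le> 1" for n \<omega>
    using h by (intro prod_le_1) auto
  let ?q = "l / (l + \<nu>)"
  show ?thesis
  proof (rule tendsto_sandwich)
    show "\<forall>\<^sub>F n in sequentially. ennreal (G 0) \<le> (\<integral>\<^sup>+\<omega>. ?H n \<omega> \<partial>M)"
    proof (intro always_eventually allI)
      fix n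
      have "ennreal (G 0) = (\<integral>\<^sup>+\<omega>. ?H n \<omega> * ennreal (G (walk W n \<omega>)) \<partial>M)"
        using E by simp
      also have "\<dots> \<le> (\<integral>\<^sup>+\<omega>. ?H n \<omega> * 1 \<partial>M)"
        using G by (intro nn_integral_mono mult_left_mono) auto
      finally show "ennreal (G 0) \<le> (\<integral>\<^sup>+\<omega>. ?H n \<omega> \<partial>M)" by simp
    qed
    show "\<forall>\<^sub>F n in sequentially. (\<integral>\<^sup>+\<omega>. ?H n \<omega> \<partial>M) \<le> ennreal (G 0) + ennreal C * ennreal (?q ^ n)"
    proof (intro always_eventually allI)
      fix n
      have "?H n \<omega> \<le> ?H n \<omega> * ennreal (G (walk W n \<omega>)) + ennreal C * ennreal (exp (- \<nu> * walk W n \<omega>))" for \<omega>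
      proof -
        have "ennreal 1 \<le> ennreal (G (walk W n \<omega>)) + ennreal C * ennreal (exp (- \<nu> * walk W n \<omega>))"
          using bound[of "walk W n \<omega>"] G \<open>0 \<le> C\<close>
          by (simp add: ennreal_mult[symmetric] ennreal_plus[symmetric] del: ennreal_1 ennreal_plus)
        then have "?H n \<omega> * 1 \<le> ?H n \<omega> * (ennreal (G (walk W n \<omega>)) + ennreal C * ennreal (exp (- \<nu> * walk W n \<omega>)))"
          by (intro mult_left_mono) auto
        also have "\<dots> \<le> ?H n \<omega> * ennreal (G (walk W n \<omega>)) + 1 * (ennreal C * ennreal (exp (- \<nu> * walk W n \<omega>)))"
          unfolding distrib_left using H1 by (intro add_mono mult_right_mono) auto
        finally show ?thesis by simp
      qed
      then have "(\<integral>\<^sup>+\<omega>. ?H n \<omega> \<partial>M) \<le> (\<integral>\<^sup>+\<omega>. ?H n \<omega> * ennreal (G (walk W n \<omega>)) + ennreal C * ennreal (exp (- \<nu> * walk W n \<omega>)) \<partial>M)"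
        by (rule nn_integral_mono)
      also have "\<dots> = ennreal (G 0) + ennreal C * ennreal (?q ^ n)"
        using nn_integral_exp_walk[OF \<open>0 < \<nu>\<close>, of n] E
        by (simp add: nn_integral_add nn_integral_cmult)
      finally show "(\<integral>\<^sup>+\<omega>. ?H n \<omega> \<partial>M) \<le> ennreal (G 0) + ennreal C * ennreal (?q ^ n)" .
    qed
    have "(\<lambda>n. G 0 + C * ?q ^ n) \<longlonglongrightarrow> G 0 + C * 0"
      using l \<open>0 < \<nu>\<close> by (intro tendsto_intros LIMSEQ_realpow_zero) auto
    from tendsto_ennrealI[OF this]
    show "(\<lambda>n. ennreal (G 0) + ennreal C * ennreal (?q ^ n)) \<longlonglongrightarrow> ennreal (G 0)"
      using G l \<open>0 < \<nu>\<close> \<open>0 \<le> C\<close> by (simp add: ennreal_mult)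
  qed simp
qed

end

section \<open>Thinned arrivals on either side of the origin\<close>

text \<open>
  The expected weight of an arrival at time \<open>s\<close> when a user still active at time \<open>t\<close> has mean weight
  \<open>1 - c\<close> and every other user has weight 1.
\<close>

definition thinning :: "real \<Rightarrow> real \<Rightarrow> real \<Rightarrow> real \<Rightarrow> real" where
  "thinning \<nu> t c s = 1 - c * (if s \<le> t then exp (- \<nu> * (t - s)) else 0)"

lemma measurable_thinning [measurable]: "thinning \<nu> t c \<in> borel_measurable borel"
  unfolding thinning_def[abs_def] by measurable

lemma thinning_bounds:
  assumes "0 < \<nu>" "0 \<le> c" "c \<le> 1"
  shows "0 \<le> thinning \<nu> t c s" "thinning \<nu> t c s \<le> 1"
proof -
  let ?e = "if s \<le> t then exp (- \<nu> * (t - s)) else 0"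
  have "0 \<le> ?e" "?e \<le> 1" using assms by auto
  then have "0 \<le> c * ?e" "c * ?e \<le> 1"
    using assms by (auto intro: mult_le_one)
  then show "0 \<le> thinning \<nu> t c s" "thinning \<nu> t c s \<le> 1"
    unfolding thinning_def by linarith+
qed

text \<open>The singletons \<open>{f j}\<close> are disjoint by injectivity, so restricting
  \<open>X\<close> to them gives independent blocks, from which the single coordinate is read
  off.\<close>

lemma (in prob_space) indep_vars_reindex:
  assumes "indep_vars (\<lambda>_. N) X I" "inj_on f J" "f ` J \<subseteq> I"
  shows "indep_vars (\<lambda>_. N) (\<lambda>j. X (f j)) J"
proof -
  have "indep_vars (\<lambda>j. PiM {f j} (\<lambda>_. N)) (\<lambda>j \<omega>. \<lambda>i\<in>{f j}. X i \<omega>) J"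
    using assms(2,3) by (intro indep_vars_restrict[OF assms(1)]) (auto simp: disjoint_family_on_def inj_on_def)
  then have "indep_vars (\<lambda>_. N) (\<lambda>j \<omega>. (\<lambda>i\<in>{f j}. X i \<omega>) (f j)) J"
    by (rule indep_vars_compose2) simp
  then show ?thesis by simp
qed

context exponential_walk
begin

text \<open>
  The function \<open>G x = exp (- l \<integral> (1 - h))\<close>, the integral being over \<open>{x..}\<close>, is written with \<open>max\<close> so that it is
  continuous across \<open>x = t\<close> and needs no case distinction on the sign of \<open>t\<close>.
\<close>

lemma forward_thinning_tendsto:
  assumes "0 < \<nu>" "0 \<le> c" "c \<le> 1"
  shows "(\<lambda>n. \<integral>\<^sup>+\<omega>. (\<Prod>k<n. ennreal (thinning \<nu> t c (walk W (Suc k) \<omega>))) \<partial>M)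
    \<longlonglongrightarrow> ennreal (exp (- (l * c / \<nu>) + l * c / \<nu> * exp (- \<nu> * max t 0)))"
proof -
  let ?\<kappa> = "l * c / \<nu>"
  have \<kappa>: "0 \<le> ?\<kappa>" using l assms by simp
  let ?G = "\<lambda>x. exp (- ?\<kappa> + ?\<kappa> * exp (- \<nu> * max (t - x) 0))"
  have "(\<lambda>n. \<integral>\<^sup>+\<omega>. (\<Prod>k<n. ennreal (thinning \<nu> t c (walk W (Suc k) \<omega>))) \<partial>M) \<longlonglongrightarrow> ennreal (?G 0)"
  proof (rule walk_prod_tendsto[where G="?G" and S="{t}" and C="exp (\<nu> * t)" and \<nu>=\<nu>])
    show "?G x \<le> 1" for x
      using mult_left_mono[OF _ \<kappa>, of "exp (- \<nu> * max (t - x) 0)" 1] \<open>0 < \<nu>\<close> by simp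
    \<comment> \<open>After \<open>t\<close> the function \<open>?G\<close> equals 1. Up to
      \<open>t\<close> the trivial bound 1 suffices, and \<open>C = exp (\<nu> * t)\<close> is
      chosen to dominate it there.\<close>
    show "1 - ?G x \<le> exp (\<nu> * t) * exp (- \<nu> * x)" for x
    proof (cases "x \<le> t")
      case True
      have "1 - ?G x \<le> 1" by simp
      also have "1 \<le> exp (\<nu> * t + - \<nu> * x)" using True \<open>0 < \<nu>\<close> by simp
      finally show ?thesis by (simp only: exp_add)
    qed simp
    show "(?G has_real_derivative l * (1 - thinning \<nu> t c x) * ?G x) (at x)" if "x \<notin> {t}" for x
    proof (cases "x < t")
      case True
      have "((\<lambda>x. exp (- ?\<kappa> + ?\<kappa> * exp (- \<nu> * (t - x)))) has_real_derivative l * (1 - thinning \<nu> t c x) * ?G x) (at x)"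
        using True \<open>0 < \<nu>\<close> by (auto intro!: derivative_eq_intros simp: thinning_def)
      then show ?thesis
        by (rule has_field_derivative_transform_within_open[where S="{..<t}"]) (use True in auto)
    next
      case False
      have "((\<lambda>x. 1) has_real_derivative l * (1 - thinning \<nu> t c x) * ?G x) (at x)"
        using False that by (auto simp: thinning_def)
      then show ?thesis
        by (rule has_field_derivative_transform_within_open[where S="{t<..}"]) (use False that in auto)
    qed
  qed (use assms in \<open>auto intro!: continuous_intros thinning_bounds\<close>)
  then show ?thesis by simp
qed

text \<open>Arrivals before the origin see the reflected weight: \<open>?G x\<close> is
  \<open>exp (- l * I)\<close> with \<open>I\<close> the integral of
  \<open>1 - thinning \<nu> t c (- y)\<close> over \<open>y \<ge> x\<close>. The exponential bound
  on \<open>1 - ?G x\<close> comes from \<open>1 - exp (- u) \<le> u\<close>.\<close>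

lemma backward_thinning_tendsto:
  assumes "0 < \<nu>" "0 \<le> c" "c \<le> 1"
  shows "(\<lambda>n. \<integral>\<^sup>+\<omega>. (\<Prod>k<n. ennreal (thinning \<nu> t c (- walk W (Suc k) \<omega>))) \<partial>M)
    \<longlonglongrightarrow> ennreal (exp (- (l * c / \<nu> * exp (- \<nu> * max t 0))))"
proof -
  let ?\<kappa> = "l * c / \<nu>"
  have \<kappa>: "0 \<le> ?\<kappa>" using l assms by simp
  let ?G = "\<lambda>x. exp (- (?\<kappa> * exp (- \<nu> * max (t + x) 0)))"
  have "(\<lambda>n. \<integral>\<^sup>+\<omega>. (\<Prod>k<n. ennreal (thinning \<nu> t c (- walk W (Suc k) \<omega>))) \<partial>M) \<longlonglongrightarrow> ennreal (?G 0)"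
  proof (rule walk_prod_tendsto[where G="?G" and S="{-t}" and C="?\<kappa> * exp (- \<nu> * t)" and \<nu>=\<nu> and h="\<lambda>x. thinning \<nu> t c (- x)"])
    show "?G x \<le> 1" for x
      using mult_nonneg_nonneg[OF \<kappa>, of "exp (- \<nu> * max (t + x) 0)"] by simp
    show "1 - ?G x \<le> ?\<kappa> * exp (- \<nu> * t) * exp (- \<nu> * x)" for x
    proof -
      have "1 - ?G x \<le> ?\<kappa> * exp (- \<nu> * max (t + x) 0)"
        using exp_ge_add_one_self[of "- (?\<kappa> * exp (- \<nu> * max (t + x) 0))"] by simp
      also have "\<dots> \<le> ?\<kappa> * exp (- \<nu> * t + - \<nu> * x)"
        using mult_left_mono[of "t + x" "max (t + x) 0" \<nu>] \<open>0 < \<nu>\<close>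
        by (intro mult_left_mono \<kappa>) (simp add: algebra_simps)
      finally show ?thesis by (simp only: exp_add mult.assoc)
    qed
    show "(?G has_real_derivative l * (1 - thinning \<nu> t c (- x)) * ?G x) (at x)" if "x \<notin> {-t}" for x
    proof (cases "-t < x")
      case True
      have "((\<lambda>x. exp (- (?\<kappa> * exp (- \<nu> * (t + x))))) has_real_derivative l * (1 - thinning \<nu> t c (- x)) * ?G x) (at x)"
        using True \<open>0 < \<nu>\<close> by (auto intro!: derivative_eq_intros simp: thinning_def)
      then show ?thesis
        by (rule has_field_derivative_transform_within_open[where S="{-t<..}"]) (use True in auto)
    next
      case False
      have "((\<lambda>x. exp (- ?\<kappa>)) has_real_derivative l * (1 - thinning \<nu> t c (- x)) * ?G x) (at x)"
        using False that by (auto simp: thinning_def)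
      then show ?thesis
        by (rule has_field_derivative_transform_within_open[where S="{..<-t}"]) (use False that in auto)
    qed
  qed (use assms in \<open>auto intro!: continuous_intros thinning_bounds\<close>)
  then show ?thesis by simp
qed

end

section \<open>Poisson arrivals on the whole time axis\<close>

text \<open>The waiting times \<open>T 1\<close> and \<open>- T 0\<close> are the first steps of the
  two walks, so index 0 already carries one step; hence \<open>Suc k\<close> steps for both
  \<open>int (Suc k)\<close> and \<open>- int k\<close>.\<close>

lemma arrivals_walk:
  "T (int (Suc k)) \<omega> = walk (\<lambda>k. interarrival T (int (Suc k))) (Suc k) \<omega>"
  "T (- int k) \<omega> = - walk (\<lambda>k. interarrival T (- int k)) (Suc k) \<omega>"
proof (induction k)
  case (Suc k)
  { case 1 then show ?case using Suc(1) by (simp add: interarrival_def) }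
  { case 2 then show ?case using Suc(2) by (simp add: interarrival_def) }
qed (simp_all add: interarrival_def)

locale poisson_arrivals = prob_space +
  fixes T :: "int \<Rightarrow> 'a \<Rightarrow> real" and l :: real
  assumes l: "0 < l" and arrivals: "homogeneous_poisson_arrivals M l T"
begin

abbreviation "fwd \<equiv> \<lambda>k::nat. interarrival T (int (Suc k))"
abbreviation "bwd \<equiv> \<lambda>k::nat. interarrival T (- int k)"

lemma indep_interarrival: "indep_vars (\<lambda>_. borel) (interarrival T) UNIV"
  using arrivals by (simp add: homogeneous_poisson_arrivals_def)

sublocale fwd: exponential_walk M fwd l
proof
  show "indep_vars (\<lambda>_. borel) fwd UNIV"
    by (intro indep_vars_reindex[OF indep_interarrival]) (auto simp: inj_def)
qed (use l arrivals in \<open>auto simp: homogeneous_poisson_arrivals_def\<close>)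

sublocale bwd: exponential_walk M bwd l
proof
  show "indep_vars (\<lambda>_. borel) bwd UNIV"
    by (intro indep_vars_reindex[OF indep_interarrival]) (auto simp: inj_def)
qed (use l arrivals in \<open>auto simp: homogeneous_poisson_arrivals_def\<close>)

lemma measurable_arrivals [measurable]: "T n \<in> borel_measurable M"
proof (cases "n \<ge> 1")
  case True
  then have n: "n = int (Suc (nat (n - 1)))" by simp
  show ?thesis
    by (subst n, subst arrivals_walk(1)[abs_def]) measurable
next
  case False
  then have n: "n = - int (nat (- n))" by simp
  show ?thesis
    by (subst n, subst arrivals_walk(2)[abs_def]) measurable
qed

text \<open>Arrivals after and before the origin are functions of the interarrival times with
  indices in the disjoint sets \<open>{1..}\<close> and \<open>{..0}\<close>.\<close>

lemma nn_integral_two_sided: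
  assumes [measurable]: "h \<in> borel_measurable borel"
  shows "(\<integral>\<^sup>+\<omega>. (\<Prod>k<n. h (T (int (Suc k)) \<omega>)) * (\<Prod>k<n. h (T (- int k) \<omega>)) \<partial>M) =
    (\<integral>\<^sup>+\<omega>. (\<Prod>k<n. h (walk fwd (Suc k) \<omega>)) \<partial>M) * (\<integral>\<^sup>+\<omega>. (\<Prod>k<n. h (- walk bwd (Suc k) \<omega>)) \<partial>M)"
proof -
  let ?A = "{1..} :: int set" and ?B = "{..0} :: int set"
  let ?R = "\<lambda>I \<omega>. \<lambda>i\<in>I. interarrival T i \<omega>"
  let ?F = "\<lambda>y. \<Prod>k<n. h (\<Sum>i<Suc k. y (int (Suc i)) :: real)"
  let ?G = "\<lambda>y. \<Prod>k<n. h (- (\<Sum>i<Suc k. y (- int i) :: real))"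
  have ind: "indep_var (PiM ?A (\<lambda>_. borel)) (?R ?A) (PiM ?B (\<lambda>_. borel)) (?R ?B)"
    by (rule indep_var_restrict[OF indep_interarrival]) auto
  have [measurable]: "?F \<in> borel_measurable (PiM ?A (\<lambda>_. borel))" "?G \<in> borel_measurable (PiM ?B (\<lambda>_. borel))"
    by (intro borel_measurable_prod_ennreal measurable_compose[OF _ assms] borel_measurable_uminus
        borel_measurable_sum measurable_component_singleton; simp)+
  have F: "?F (?R ?A \<omega>) = (\<Prod>k<n. h (walk fwd (Suc k) \<omega>))" for \<omega>
    unfolding walk_def by simp
  have G: "?G (?R ?B \<omega>) = (\<Prod>k<n. h (- walk bwd (Suc k) \<omega>))" for \<omega>
    unfolding walk_def by simp
  let ?f = "\<lambda>(y, z). ?F y * ?G z"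
  have "(\<integral>\<^sup>+\<omega>. (\<Prod>k<n. h (T (int (Suc k)) \<omega>)) * (\<Prod>k<n. h (T (- int k) \<omega>)) \<partial>M)
    = (\<integral>\<^sup>+\<omega>. ?f (?R ?A \<omega>, ?R ?B \<omega>) \<partial>M)"
    by (simp only: split F G arrivals_walk)
  also have "\<dots> = (\<integral>\<^sup>+\<omega>. \<integral>\<^sup>+\<omega>'. ?f (?R ?A \<omega>, ?R ?B \<omega>') \<partial>M \<partial>M)"
    by (rule indep_var_nn_integral[OF ind]) measurable
  also have "\<dots> = (\<integral>\<^sup>+\<omega>. (\<Prod>k<n. h (walk fwd (Suc k) \<omega>)) * (\<integral>\<^sup>+\<omega>'. (\<Prod>k<n. h (- walk bwd (Suc k) \<omega>')) \<partial>M) \<partial>M)"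
    unfolding split F G by (intro nn_integral_cong nn_integral_cmult) measurable
  also have "\<dots> = (\<integral>\<^sup>+\<omega>. (\<Prod>k<n. h (walk fwd (Suc k) \<omega>)) \<partial>M) * (\<integral>\<^sup>+\<omega>. (\<Prod>k<n. h (- walk bwd (Suc k) \<omega>)) \<partial>M)"
    by (intro nn_integral_multc) measurable
  finally show ?thesis .
qed

text \<open>The terms containing \<open>t\<close> in the exponents of the two one-sided limits
  cancel, which reflects the stationarity of the arrivals.\<close>

lemma arrivals_thinning_tendsto:
  assumes "0 < \<nu>" "0 \<le> c" "c \<le> 1"
  shows "(\<lambda>n. \<integral>\<^sup>+\<omega>. (\<Prod>k<n. ennreal (thinning \<nu> t c (T (int (Suc k)) \<omega>))) *
      (\<Prod>k<n. ennreal (thinning \<nu> t c (T (- int k) \<omega>))) \<partial>M) \<longlonglongrightarrow> ennreal (exp (- (l * c / \<nu>)))"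
proof -
  have "exp (- (l * c / \<nu>) + l * c / \<nu> * exp (- \<nu> * max t 0)) * exp (- (l * c / \<nu> * exp (- \<nu> * max t 0)))
    = exp (- (l * c / \<nu>))"
    by (simp add: exp_add[symmetric])
  with tendsto_mult_ennreal[OF fwd.forward_thinning_tendsto[OF assms, of t] bwd.backward_thinning_tendsto[OF assms, of t]]
  show ?thesis
    by (subst nn_integral_two_sided) (simp_all add: ennreal_mult[symmetric])
qed

text \<open>These geometric rates make the activity probabilities summable in
  \<open>AE_finite_active\<close>.\<close>

lemma nn_integral_exp_arrivals:
  assumes "0 < \<nu>"
  shows "(\<integral>\<^sup>+\<omega>. ennreal (exp (- \<nu> * T (int (Suc k)) \<omega>)) \<partial>M) = ennreal ((l / (l + \<nu>)) ^ Suc k)"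
    and "(\<integral>\<^sup>+\<omega>. ennreal (exp (\<nu> * T (- int k) \<omega>)) \<partial>M) = ennreal ((l / (l + \<nu>)) ^ Suc k)"
  using fwd.nn_integral_exp_walk[OF assms, of "Suc k"] bwd.nn_integral_exp_walk[OF assms, of "Suc k"]
  by (simp_all only: arrivals_walk mult_minus_left mult_minus_right minus_minus)

end

section \<open>Probability generating functions\<close>

text \<open>The difference of the two series vanishes on \<open>[0, 1)\<close>, so 0 is not an
  isolated zero of it. A power series with zero constant term and some nonzero coefficient would
  have an isolated zero there.\<close>

lemma power_series_eqI:
  fixes u v :: "nat \<Rightarrow> real"
  assumes u: "\<And>z. 0 \<le> z \<Longrightarrow> z < 1 \<Longrightarrow> (\<lambda>k. u k * z ^ k) sums F z"
    and v: "\<And>z. 0 \<le> z \<Longrightarrow> z < 1 \<Longrightarrow> (\<lambda>k. v k * z ^ k) sums F z"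
  shows "u k = v k"
proof (rule ccontr)
  let ?d = "\<lambda>k. u k - v k"
  assume "u k \<noteq> v k"
  have d: "(\<lambda>k. ?d k * z ^ k) sums 0" if "0 \<le> z" "z < 1" for z
    using sums_diff[OF u[OF that] v[OF that]] by (simp add: left_diff_distrib)
  have d0: "u 0 = v 0"
    using sums_unique2[OF d[of 0] powser_sums_zero[of ?d]] by simp
  have "k > 0"
    using d0 \<open>u k \<noteq> v k\<close> by (cases k) auto
  have sm: "(\<lambda>k. ?d k * (z - 0) ^ k) sums (\<Sum>k. ?d k * z ^ k)" if "norm (z - 0) < 1" for z :: real
  proof -
    \<comment> \<open>Convergence is known for nonnegative arguments only; a point \<open>x\<close>
      between \<open>\<bar>z\<bar>\<close> and 1 transfers it to every \<open>z\<close> in the open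
      unit ball.\<close>
    obtain x where x: "\<bar>z\<bar> < x" "x < 1"
      using dense[of "\<bar>z\<bar>" 1] \<open>norm (z - 0) < 1\<close> by auto
    have "summable (\<lambda>k. ?d k * z ^ k)"
      by (rule powser_inside[OF sums_summable[OF d[of x]]]) (use x in auto)
    then show ?thesis by (simp add: summable_sums)
  qed
  have f0: "(\<Sum>k. ?d k * 0 ^ k) = 0"
    using d0 by (simp only: powser_zero diff_self)
  have dk: "?d k \<noteq> 0"
    using \<open>u k \<noteq> v k\<close> by simp
  obtain s where s: "0 < s" "\<And>z. z \<in> cball 0 s - {0} \<Longrightarrow> (\<Sum>k. ?d k * z ^ k) \<noteq> 0"
    using powser_0_nonzero[OF zero_less_one sm f0 dk \<open>0 < k\<close>] by metis
  \<comment> \<open>\<open>min s (1/2)\<close> lies in the punctured ball and also below 1, where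
    the difference is known to vanish.\<close>
  have "(\<Sum>k. ?d k * (min s (1/2)) ^ k) = 0"
    using s(1) by (intro sums_unique[symmetric] d) auto
  moreover have "min s (1/2) \<in> cball 0 s - {0}"
    using s(1) by auto
  ultimately show False
    using s(2) by metis
qed

lemma poisson_pgf_sums:
  fixes a z :: real
  shows "(\<lambda>k. a ^ k / fact k * exp (- a) * z ^ k) sums exp (- a * (1 - z))"
proof -
  have "(\<lambda>k. exp (- a) * ((a * z) ^ k /\<^sub>R fact k)) sums (exp (- a) * exp (a * z))"
    by (intro sums_mult exp_converges)
  moreover have "exp (- a) * exp (a * z) = exp (- a * (1 - z))"
    by (simp add: exp_add[symmetric] algebra_simps)
  ultimately show ?thesis
    by (simp add: power_mult_distrib field_simps)
qed

text \<open>The weight \<open>Y\<close> makes it possible to expand a joint generating function in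
  one variable while the other is kept. The series arises from truncation at \<open>N < n\<close>
  and dominated convergence.\<close>

lemma (in prob_space) pgf_sums:
  fixes N :: "'a \<Rightarrow> nat" and Y :: "'a \<Rightarrow> real"
  assumes [measurable]: "N \<in> M \<rightarrow>\<^sub>M count_space UNIV" "Y \<in> borel_measurable M"
    and Y: "\<And>\<omega>. 0 \<le> Y \<omega>" "\<And>\<omega>. Y \<omega> \<le> 1" and z: "0 \<le> z" "z \<le> 1"
  shows "(\<lambda>k. (\<integral>\<omega>. Y \<omega> * indicator {k} (N \<omega>) \<partial>M) * z ^ k) sums (\<integral>\<omega>. Y \<omega> * z ^ N \<omega> \<partial>M)"
  unfolding sums_def
proof (rule Lim_transform_eventually)
  have le1: "\<bar>Y \<omega> * z ^ n\<bar> \<le> 1" for \<omega> n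
    using Y[of \<omega>] z power_le_one[of z n] by (auto simp: abs_mult intro!: mult_le_one)
  show "(\<lambda>n. \<integral>\<omega>. Y \<omega> * z ^ N \<omega> * indicator {..<n} (N \<omega>) \<partial>M) \<longlonglongrightarrow> (\<integral>\<omega>. Y \<omega> * z ^ N \<omega> \<partial>M)"
  proof (rule integral_dominated_convergence[where w="\<lambda>_. 1"])
    show "AE \<omega> in M. (\<lambda>n. Y \<omega> * z ^ N \<omega> * indicator {..<n} (N \<omega>)) \<longlonglongrightarrow> Y \<omega> * z ^ N \<omega>"
    proof (intro AE_I2 tendsto_eventually)
      show "\<forall>\<^sub>F n in sequentially. Y \<omega> * z ^ N \<omega> * indicator {..<n} (N \<omega>) = Y \<omega> * z ^ N \<omega>" for \<omega>
        using eventually_gt_at_top[of "N \<omega>"] by eventually_elim auto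
    qed
  qed (use le1 in \<open>auto simp: indicator_def\<close>)
  show "\<forall>\<^sub>F n in sequentially. (\<integral>\<omega>. Y \<omega> * z ^ N \<omega> * indicator {..<n} (N \<omega>) \<partial>M) =
    (\<Sum>k<n. (\<integral>\<omega>. Y \<omega> * indicator {k} (N \<omega>) \<partial>M) * z ^ k)"
  proof (intro always_eventually allI)
    fix n
    have int: "integrable M (\<lambda>\<omega>. Y \<omega> * indicator {k} (N \<omega>))" for k
      using Y by (intro integrable_const_bound[of _ 1]) (auto simp: indicator_def)
    have "(\<Sum>k<n. Y \<omega> * indicator {k} (N \<omega>) * z ^ k) = Y \<omega> * z ^ N \<omega> * indicator {..<n} (N \<omega>)" for \<omega>
    proof -
      have "(\<Sum>k<n. Y \<omega> * indicator {k} (N \<omega>) * z ^ k) = (\<Sum>k<n. if k = N \<omega> then Y \<omega> * z ^ k else 0)"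
        by (intro sum.cong) auto
      then show ?thesis by (simp add: sum.delta)
    qed
    then have "(\<integral>\<omega>. Y \<omega> * z ^ N \<omega> * indicator {..<n} (N \<omega>) \<partial>M)
      = (\<integral>\<omega>. (\<Sum>k<n. Y \<omega> * indicator {k} (N \<omega>) * z ^ k) \<partial>M)"
      by simp
    also have "\<dots> = (\<Sum>k<n. (\<integral>\<omega>. Y \<omega> * indicator {k} (N \<omega>) \<partial>M) * z ^ k)"
      using int by (subst Bochner_Integration.integral_sum) auto
    finally show "(\<integral>\<omega>. Y \<omega> * z ^ N \<omega> * indicator {..<n} (N \<omega>) \<partial>M) =
      (\<Sum>k<n. (\<integral>\<omega>. Y \<omega> * indicator {k} (N \<omega>) \<partial>M) * z ^ k)" .
  qed
qed

text \<open>On the countable space of pairs a law is determined by its point masses, so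
  \<open>prod\<close> identifies the joint law with the product law.\<close>

lemma (in prob_space) indep_var_count_spaceI:
  fixes N N' :: "'a \<Rightarrow> nat"
  assumes [measurable]: "N \<in> M \<rightarrow>\<^sub>M count_space UNIV" "N' \<in> M \<rightarrow>\<^sub>M count_space UNIV"
    and prod: "\<And>k m. \<P>(\<omega> in M. N \<omega> = k \<and> N' \<omega> = m) = \<P>(\<omega> in M. N \<omega> = k) * \<P>(\<omega> in M. N' \<omega> = m)"
  shows "indep_var (count_space UNIV) N (count_space UNIV) N'"
  unfolding indep_var_distribution_eq
proof (intro conjI measure_eqI_countable)
  let ?D = "distr M (count_space UNIV)"
  interpret N': prob_space "?D N'"
    by (rule prob_space_distr) simp
  show "sets (?D N \<Otimes>\<^sub>M ?D N') = Pow UNIV"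
    by (subst sets_pair_countable[where ?S1.0=UNIV and ?S2.0=UNIV]) auto
  show "sets (distr M (count_space UNIV \<Otimes>\<^sub>M count_space UNIV) (\<lambda>\<omega>. (N \<omega>, N' \<omega>))) = Pow UNIV"
    by (simp add: sets_pair_countable[where ?S1.0=UNIV and ?S2.0=UNIV])
  fix p :: "nat \<times> nat"
  obtain k m where p: "p = (k, m)" by (cases p)
  have "emeasure (?D N \<Otimes>\<^sub>M ?D N') {p} = emeasure (?D N) {k} * emeasure (?D N') {m}"
    using N'.emeasure_pair_measure_Times[of "{k}" "?D N" "{m}"] by (simp add: p)
  also have "\<dots> = ennreal (\<P>(\<omega> in M. N \<omega> = k) * \<P>(\<omega> in M. N' \<omega> = m))"
    by (simp add: emeasure_distr emeasure_eq_measure ennreal_mult vimage_def Int_def conj_commute)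
  also have "\<dots> = emeasure (distr M (count_space UNIV \<Otimes>\<^sub>M count_space UNIV) (\<lambda>\<omega>. (N \<omega>, N' \<omega>))) {p}"
    unfolding prod[symmetric]
    by (subst emeasure_distr)
      (auto simp: emeasure_eq_measure p sets_pair_countable[where ?S1.0=UNIV and ?S2.0=UNIV] intro!: arg_cong[where f=prob])
  finally show "emeasure (?D N \<Otimes>\<^sub>M ?D N') {p} =
    emeasure (distr M (count_space UNIV \<Otimes>\<^sub>M count_space UNIV) (\<lambda>\<omega>. (N \<omega>, N' \<omega>))) {p}" .
qed auto

text \<open>Coefficients are compared in one variable at a time: first in \<open>z\<close>, with
  weight \<open>z' ^ N'\<close>, then in \<open>z'\<close>, with weight
  \<open>indicator {k} (N \<omega>)\<close>. The marginals come from setting the other argument to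
  1.\<close>

lemma (in prob_space) joint_poisson_pgf:
  fixes N N' :: "'a \<Rightarrow> nat"
  assumes [measurable]: "N \<in> M \<rightarrow>\<^sub>M count_space UNIV" "N' \<in> M \<rightarrow>\<^sub>M count_space UNIV"
    and pgf: "\<And>z z'. 0 \<le> z \<Longrightarrow> z \<le> 1 \<Longrightarrow> 0 \<le> z' \<Longrightarrow> z' \<le> 1 \<Longrightarrow>
      (\<integral>\<omega>. z' ^ N' \<omega> * z ^ N \<omega> \<partial>M) = exp (- a * (1 - z)) * exp (- b * (1 - z'))"
  shows "\<P>(\<omega> in M. N \<omega> = k) = a ^ k / fact k * exp (- a)"
    and "indep_var (count_space UNIV) N (count_space UNIV) N'"
proof -
  let ?p = "\<lambda>a k. a ^ k / fact k * exp (- a) :: real"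
  have 1: "(\<integral>\<omega>. z' ^ N' \<omega> * indicator {k} (N \<omega>) \<partial>M) = ?p a k * exp (- b * (1 - z'))"
    if "0 \<le> z'" "z' \<le> 1" for z' k
  proof (rule power_series_eqI)
    fix z :: real assume z: "0 \<le> z" "z < 1"
    then show "(\<lambda>k. (\<integral>\<omega>. z' ^ N' \<omega> * indicator {k} (N \<omega>) \<partial>M) * z ^ k) sums (exp (- a * (1 - z)) * exp (- b * (1 - z')))"
      using pgf_sums[of N "\<lambda>\<omega>. z' ^ N' \<omega>" z] that by (simp add: pgf power_le_one)
    show "(\<lambda>k. ?p a k * exp (- b * (1 - z')) * z ^ k) sums (exp (- a * (1 - z)) * exp (- b * (1 - z')))"
      using sums_mult2[OF poisson_pgf_sums[of a z], of "exp (- b * (1 - z'))"] by (simp add: mult_ac)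
  qed
  have eq1: "(indicator {k} (N \<omega>) :: real) = indicator {\<omega>. N \<omega> = k} \<omega>" for k \<omega>
    by (simp add: indicator_def)
  have eq1': "(indicator {k} (N' \<omega>) :: real) = indicator {\<omega>. N' \<omega> = k} \<omega>" for k \<omega>
    by (simp add: indicator_def)
  have eq: "(indicator {k} (N \<omega>) * indicator {m} (N' \<omega>) :: real) = indicator {\<omega>. N \<omega> = k \<and> N' \<omega> = m} \<omega>" for k m \<omega>
    by (simp add: indicator_def)
  have [measurable]: "(\<lambda>\<omega>. indicator {k} (N \<omega>) :: real) \<in> borel_measurable M" for k
    by (rule measurable_compose[OF assms(1)]) simp
  have marg: "\<P>(\<omega> in M. N \<omega> = k) = ?p a k" for k
    using 1[of 1 k] by (simp add: eq1 Int_def conj_commute)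
  have joint: "\<P>(\<omega> in M. N \<omega> = k \<and> N' \<omega> = m) = ?p a k * ?p b m" for k m
  proof -
    have "(\<integral>\<omega>. indicator {k} (N \<omega>) * indicator {m} (N' \<omega>) \<partial>M) = ?p a k * ?p b m"
    proof (rule power_series_eqI)
      fix z' :: real assume z': "0 \<le> z'" "z' < 1"
      then show "(\<lambda>m. (\<integral>\<omega>. indicator {k} (N \<omega>) * indicator {m} (N' \<omega>) \<partial>M) * z' ^ m) sums (?p a k * exp (- b * (1 - z')))"
        using pgf_sums[of N' "\<lambda>\<omega>. indicator {k} (N \<omega>)" z'] 1[of z' k] by (simp add: mult.commute)
      show "(\<lambda>m. ?p a k * ?p b m * z' ^ m) sums (?p a k * exp (- b * (1 - z')))"
        using sums_mult[OF poisson_pgf_sums[of b z'], of "?p a k"] by (simp only: mult_ac)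
    qed
    then show ?thesis by (simp add: eq Int_def conj_commute conj_left_commute)
  qed
  have marg': "\<P>(\<omega> in M. N' \<omega> = m) = ?p b m" for m
  proof (rule power_series_eqI)
    fix z' :: real assume z': "0 \<le> z'" "z' < 1"
    have "(\<lambda>m. (\<integral>\<omega>. 1 * indicator {m} (N' \<omega>) \<partial>M) * z' ^ m) sums (\<integral>\<omega>. 1 * z' ^ N' \<omega> \<partial>M)"
      using z' by (intro pgf_sums) auto
    also have "(\<integral>\<omega>. 1 * z' ^ N' \<omega> \<partial>M) = exp (- b * (1 - z'))"
      using pgf[of 1 z'] z' by simp
    finally show "(\<lambda>m. \<P>(\<omega> in M. N' \<omega> = m) * z' ^ m) sums exp (- b * (1 - z'))"
      by (simp add: eq1' Int_def conj_commute)
  qed (rule poisson_pgf_sums)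
  show "\<P>(\<omega> in M. N \<omega> = k) = a ^ k / fact k * exp (- a)"
    by (rule marg)
  show "indep_var (count_space UNIV) N (count_space UNIV) N'"
    by (rule indep_var_count_spaceI) (simp_all add: joint marg marg')
qed

section \<open>Arrivals marked with positions and service times\<close>

locale poisson_service = poisson_arrivals M T l
  for M :: "'w measure" and T :: "int \<Rightarrow> 'w \<Rightarrow> real" and l :: real +
  fixes X :: "int \<Rightarrow> 'w \<Rightarrow> 'a::euclidean_space" and f :: "'a \<Rightarrow> real"
    and S :: "int \<Rightarrow> 'w \<Rightarrow> real" and \<nu> t :: real
  assumes \<nu>: "0 < \<nu>"
    and X: "iid_with_density M f X"
    and S: "iid_with_density M (exponential_density \<nu>) S"
    and indep_families: "mutually_indep_families M T X S"
begin

lemma distr_X: "distributed M lborel (X n) f"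
  and indep_X: "indep_vars (\<lambda>_. borel) X UNIV"
  using X by (auto simp: iid_with_density_def)

lemma distr_S: "distributed M lborel (S n) (exponential_density \<nu>)"
  and indep_S: "indep_vars (\<lambda>_. borel) S UNIV"
  using S by (auto simp: iid_with_density_def)

lemma measurable_X [measurable]: "X n \<in> borel_measurable M"
  using distr_X[of n] by (simp add: distributed_def)

lemma measurable_S [measurable]: "S n \<in> borel_measurable M"
  using distr_S[of n] by (simp add: distributed_def)

lemma measurable_f [measurable]: "(\<lambda>x. ennreal (f x)) \<in> borel_measurable borel"
  using distr_X[of 0] by (simp add: distributed_def)

abbreviation "seq \<equiv> PiM UNIV (\<lambda>_::int. borel)"
abbreviation "preimages Y N \<equiv> {Y -` a \<inter> space M |a. a \<in> sets N}"

lemma measurable_seq: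
  "(\<lambda>\<omega> n. T n \<omega>) \<in> M \<rightarrow>\<^sub>M seq" "(\<lambda>\<omega> n. X n \<omega>) \<in> M \<rightarrow>\<^sub>M seq" "(\<lambda>\<omega> n. S n \<omega>) \<in> M \<rightarrow>\<^sub>M seq"
  by (auto intro!: measurable_PiM_single')

lemma preimages_eq:
  fixes Y :: "int \<Rightarrow> 'w \<Rightarrow> 'c::topological_space"
  shows "sets (vimage_algebra (space M) (\<lambda>\<omega> n. Y n \<omega>) seq) = preimages (\<lambda>\<omega> n. Y n \<omega>) seq"
  by (rule sets_vimage_algebra2) (simp add: space_PiM)

lemma indep_preimages:
  "indep_sets (\<lambda>i::nat. if i = 0 then preimages (\<lambda>\<omega> n. T n \<omega>) seq
     else if i = 1 then preimages (\<lambda>\<omega> n. X n \<omega>) seq else preimages (\<lambda>\<omega> n. S n \<omega>) seq) {0, 1, 2}"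
  using indep_families unfolding mutually_indep_families_def preimages_eq .

lemma indep_X_S: "indep_set (preimages (\<lambda>\<omega> n. X n \<omega>) seq) (preimages (\<lambda>\<omega> n. S n \<omega>) seq)"
proof (rule indep_setI)
  fix a b assume "a \<in> preimages (\<lambda>\<omega> n. X n \<omega>) seq" "b \<in> preimages (\<lambda>\<omega> n. S n \<omega>) seq"
  then show "prob (a \<inter> b) = prob a * prob b"
    using indep_setsD[OF indep_preimages, of "{1, 2}" "\<lambda>i. if i = 1 then a else b"] by (simp add: Int_commute)
qed (use measurable_seq in \<open>auto intro: measurable_sets\<close>)

text \<open>Mutual independence survives grouping: the generators are stable under intersection, so
  the sigma-algebra of \<open>T\<close> is independent of the one generated by those of
  \<open>X\<close> and \<open>S\<close> together.\<close>

lemma indep_T_XS: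
  "indep_set (preimages (\<lambda>\<omega> n. T n \<omega>) seq) (preimages (\<lambda>\<omega>. (\<lambda>n. X n \<omega>, \<lambda>n. S n \<omega>)) (seq \<Otimes>\<^sub>M seq))"
proof -
  let ?E = "\<lambda>i::nat. if i = 0 then preimages (\<lambda>\<omega> n. T n \<omega>) seq
     else if i = 1 then preimages (\<lambda>\<omega> n. X n \<omega>) seq else preimages (\<lambda>\<omega> n. S n \<omega>) seq"
  let ?I = "\<lambda>j. if j then {0} else {1, 2::nat}"
  have stable: "Int_stable (preimages Y N)" for Y and N :: "'x measure"
  proof (rule Int_stableI)
    fix a b assume "a \<in> preimages Y N" "b \<in> preimages Y N"
    then obtain a' b' where "a' \<in> sets N" "b' \<in> sets N" "a = Y -` a' \<inter> space M" "b = Y -` b' \<inter> space M" by auto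
    then show "a \<inter> b \<in> preimages Y N"
      by (auto intro!: exI[of _ "a' \<inter> b'"])
  qed
  have "indep_sets (\<lambda>j. sigma_sets (space M) (\<Union>i\<in>?I j. ?E i)) UNIV"
  proof (rule indep_sets_collect_sigma)
    have "(\<Union>j. ?I j) = {0, 1, 2}" by (auto simp: UNIV_bool)
    then show "indep_sets ?E (\<Union>j. ?I j)"
      using indep_preimages by simp
  qed (auto simp: disjoint_family_on_def intro: stable)
  then show ?thesis
    unfolding indep_set_def
  proof (rule indep_sets_mono_sets)
    fix j :: bool
    \<comment> \<open>\<open>?N\<close> carries the least sigma-algebra making both sequences
      measurable. The pair is then measurable too, so its preimages lie in that
      sigma-algebra.\<close>
    let ?N = "sigma (space M) (?E 1 \<union> ?E 2)"
    have sub: "?E 1 \<union> ?E 2 \<subseteq> Pow (space M)" by auto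
    have N: "sets ?N = sigma_sets (space M) (?E 1 \<union> ?E 2)" "space ?N = space M"
      using sub by (simp_all add: sets_measure_of space_measure_of)
    have "(\<lambda>\<omega> n. X n \<omega>) \<in> ?N \<rightarrow>\<^sub>M seq" "(\<lambda>\<omega> n. S n \<omega>) \<in> ?N \<rightarrow>\<^sub>M seq"
      unfolding measurable_def N by (auto simp: space_PiM intro!: sigma_sets.Basic)
    then have "(\<lambda>\<omega>. (\<lambda>n. X n \<omega>, \<lambda>n. S n \<omega>)) \<in> ?N \<rightarrow>\<^sub>M seq \<Otimes>\<^sub>M seq"
      by (rule measurable_Pair)
    from measurable_sets[OF this]
    have "preimages (\<lambda>\<omega>. (\<lambda>n. X n \<omega>, \<lambda>n. S n \<omega>)) (seq \<Otimes>\<^sub>M seq) \<subseteq> sigma_sets (space M) (?E 1 \<union> ?E 2)"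
      unfolding N by blast
    moreover have "(\<Union>i\<in>{1, 2}. ?E i) = ?E 1 \<union> ?E 2" by (simp add: Un_commute)
    ultimately show "case_bool (preimages (\<lambda>\<omega> n. T n \<omega>) seq) (preimages (\<lambda>\<omega>. (\<lambda>n. X n \<omega>, \<lambda>n. S n \<omega>)) (seq \<Otimes>\<^sub>M seq)) j
      \<subseteq> sigma_sets (space M) (\<Union>i\<in>?I j. ?E i)"
      by (cases j) (simp_all only: if_True if_False bool.case, auto intro: sigma_sets.Basic)
  qed
qed

text \<open>The factor contributed by a user with arrival time \<open>\<tau>\<close>, position
  \<open>x\<close> and service time \<open>s\<close>. If \<open>m\<close> is \<open>z\<close> on
  \<open>A\<close>, \<open>z'\<close> on a disjoint \<open>A'\<close> and 1 elsewhere, the product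
  over the users is the variable whose mean is the joint generating function.\<close>

definition weight :: "('a \<Rightarrow> real) \<Rightarrow> real \<Rightarrow> 'a \<Rightarrow> real \<Rightarrow> real" where
  "weight m \<tau> x s = (if \<tau> \<le> t \<and> t < \<tau> + s then m x else 1)"

lemma measurable_weight [measurable (raw)]:
  assumes [measurable]: "m \<in> borel_measurable borel" "a \<in> borel_measurable N" "b \<in> borel_measurable N" "c \<in> borel_measurable N"
  shows "(\<lambda>y. weight m (a y) (b y) (c y)) \<in> borel_measurable N"
  unfolding weight_def by measurable

text \<open>A user arriving at \<open>\<tau> \<le> t\<close> is still active with the exponential
  tail probability \<open>exp (- \<nu> * (t - \<tau>))\<close>, and only then is the weight
  \<open>m x\<close> instead of 1.\<close>

lemma nn_integral_weight_S:
  assumes m: "\<And>x. 0 \<le> m x" "\<And>x. m x \<le> 1"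
  shows "(\<integral>\<^sup>+\<omega>. ennreal (weight m \<tau> x (S n \<omega>)) \<partial>M) = ennreal (thinning \<nu> t (1 - m x) \<tau>)"
proof (cases "\<tau> \<le> t")
  case True
  let ?A = "{\<omega>\<in>space M. t - \<tau> < S n \<omega>}"
  have pA: "prob ?A = exp (- (t - \<tau>) * \<nu>)"
    using exponential_distributedD_gt[OF distr_S _ \<nu>, of "t - \<tau>"] True by simp
  have "(\<integral>\<^sup>+\<omega>. ennreal (weight m \<tau> x (S n \<omega>)) \<partial>M)
    = (\<integral>\<^sup>+\<omega>. ennreal (m x) * indicator ?A \<omega> + indicator (space M - ?A) \<omega> \<partial>M)"
    using True by (intro nn_integral_cong) (auto simp: weight_def indicator_def)
  also have "\<dots> = ennreal (m x) * emeasure M ?A + emeasure M (space M - ?A)"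
    by (subst nn_integral_add) (auto simp: nn_integral_cmult)
  also have "\<dots> = ennreal (m x * prob ?A + (1 - prob ?A))"
    using m by (simp add: emeasure_eq_measure prob_compl ennreal_mult)
  also have "m x * prob ?A + (1 - prob ?A) = thinning \<nu> t (1 - m x) \<tau>"
    using True unfolding pA thinning_def by (simp add: algebra_simps)
  finally show ?thesis .
next
  case False
  then show ?thesis
    by (simp add: weight_def thinning_def emeasure_space_1)
qed

text \<open>\<open>thinning\<close> is affine in \<open>c\<close>, so the expectation over the
  position passes inside.\<close>

lemma nn_integral_thinning_X:
  assumes [measurable]: "m \<in> borel_measurable borel" and m: "\<And>x. 0 \<le> m x" "\<And>x. m x \<le> 1"
    and Em: "(\<integral>\<^sup>+\<omega>. ennreal (m (X n \<omega>)) \<partial>M) = ennreal e" "0 \<le> e"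
  shows "(\<integral>\<^sup>+\<omega>. ennreal (thinning \<nu> t (1 - m (X n \<omega>)) \<tau>) \<partial>M) = ennreal (thinning \<nu> t (1 - e) \<tau>)"
proof -
  let ?e = "if \<tau> \<le> t then exp (- \<nu> * (t - \<tau>)) else 0"
  have e: "0 \<le> ?e" "?e \<le> 1" using \<nu> by auto
  have th: "thinning \<nu> t (1 - r) \<tau> = (1 - ?e) + ?e * r" for r
    by (simp add: thinning_def algebra_simps)
  have "(\<integral>\<^sup>+\<omega>. ennreal (thinning \<nu> t (1 - m (X n \<omega>)) \<tau>) \<partial>M)
    = (\<integral>\<^sup>+\<omega>. ennreal (1 - ?e) + ennreal ?e * ennreal (m (X n \<omega>)) \<partial>M)"
    unfolding th using e m by (intro nn_integral_cong) (simp only: ennreal_plus ennreal_mult diff_ge_0_iff_ge mult_nonneg_nonneg)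
  also have "\<dots> = ennreal (1 - ?e) + ennreal ?e * ennreal e"
    using Em by (simp add: nn_integral_add nn_integral_cmult emeasure_space_1)
  also have "\<dots> = ennreal (thinning \<nu> t (1 - e) \<tau>)"
    unfolding th using e Em(2) by (simp only: ennreal_plus ennreal_mult diff_ge_0_iff_ge mult_nonneg_nonneg)
  finally show ?thesis .
qed

text \<open>Independence of the families gives iterated integrals: for fixed arrival times and
  positions the service times are integrated out, then the positions. In both layers independence of
  the users turns the integral of a product into a product of integrals.\<close>

lemma nn_integral_prod_weight:
  assumes [measurable]: "m \<in> borel_measurable borel" and m: "\<And>x. 0 \<le> m x" "\<And>x. m x \<le> 1"
    and Em: "\<And>n. (\<integral>\<^sup>+\<omega>. ennreal (m (X n \<omega>)) \<partial>M) = ennreal e" "0 \<le> e"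
    and "finite I"
  shows "(\<integral>\<^sup>+\<omega>. (\<Prod>n\<in>I. ennreal (weight m (T n \<omega>) (X n \<omega>) (S n \<omega>))) \<partial>M)
    = (\<integral>\<^sup>+\<omega>. (\<Prod>n\<in>I. ennreal (thinning \<nu> t (1 - e) (T n \<omega>))) \<partial>M)"
proof -
  let ?p = "\<lambda>\<tau> x s. \<Prod>n\<in>I. ennreal (weight m (\<tau> n) (x n) (s n))"
  have marks: "(\<integral>\<^sup>+\<omega>. ?p \<tau> (\<lambda>n. X n \<omega>) (\<lambda>n. S n \<omega>) \<partial>M) = (\<Prod>n\<in>I. ennreal (thinning \<nu> t (1 - e) (\<tau> n)))" for \<tau>
  proof -
    have "(\<integral>\<^sup>+\<omega>. ?p \<tau> (\<lambda>n. X n \<omega>) (\<lambda>n. S n \<omega>) \<partial>M) = (\<integral>\<^sup>+\<omega>. \<integral>\<^sup>+\<omega>'. ?p \<tau> (\<lambda>n. X n \<omega>) (\<lambda>n. S n \<omega>') \<partial>M \<partial>M)"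
      using indep_set_nn_integral[OF indep_X_S measurable_seq(2,3), of "\<lambda>(x, s). ?p \<tau> x s"] by simp
    also have "\<dots> = (\<integral>\<^sup>+\<omega>. (\<Prod>n\<in>I. ennreal (thinning \<nu> t (1 - m (X n \<omega>)) (\<tau> n))) \<partial>M)"
    proof (intro nn_integral_cong)
      fix \<omega>
      have "indep_vars (\<lambda>_. borel) (\<lambda>n \<omega>'. ennreal (weight m (\<tau> n) (X n \<omega>) (S n \<omega>'))) I"
        by (rule indep_vars_compose2[OF indep_vars_subset[OF indep_S]]) auto
      with \<open>finite I\<close> show "(\<integral>\<^sup>+\<omega>'. ?p \<tau> (\<lambda>n. X n \<omega>) (\<lambda>n. S n \<omega>') \<partial>M) = (\<Prod>n\<in>I. ennreal (thinning \<nu> t (1 - m (X n \<omega>)) (\<tau> n)))"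
        by (subst indep_vars_nn_integral) (auto simp: nn_integral_weight_S m)
    qed
    also have "\<dots> = (\<Prod>n\<in>I. \<integral>\<^sup>+\<omega>. ennreal (thinning \<nu> t (1 - m (X n \<omega>)) (\<tau> n)) \<partial>M)"
    proof (rule indep_vars_nn_integral[OF \<open>finite I\<close>])
      have [measurable]: "(\<lambda>x. thinning \<nu> t (1 - m x) \<tau>') \<in> borel_measurable borel" for \<tau>'
        unfolding thinning_def by measurable
      show "indep_vars (\<lambda>_. borel) (\<lambda>n \<omega>. ennreal (thinning \<nu> t (1 - m (X n \<omega>)) (\<tau> n))) I"
        by (rule indep_vars_compose2[OF indep_vars_subset[OF indep_X]]) auto
    qed simp
    finally show ?thesis
      using Em m by (simp add: nn_integral_thinning_X)
  qed
  have "(\<integral>\<^sup>+\<omega>. ?p (\<lambda>n. T n \<omega>) (\<lambda>n. X n \<omega>) (\<lambda>n. S n \<omega>) \<partial>M)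
    = (\<integral>\<^sup>+\<omega>. \<integral>\<^sup>+\<omega>'. ?p (\<lambda>n. T n \<omega>) (\<lambda>n. X n \<omega>') (\<lambda>n. S n \<omega>') \<partial>M \<partial>M)"
    using indep_set_nn_integral[OF indep_T_XS measurable_seq(1) measurable_Pair[OF measurable_seq(2,3)], of "\<lambda>(\<tau>, x, s). ?p \<tau> x s"]
    by simp
  then show ?thesis
    by (simp add: marks)
qed

section \<open>Finitely many active users, at distinct positions\<close>

abbreviation "active n \<omega> \<equiv> T n \<omega> \<le> t \<and> t < T n \<omega> + S n \<omega>"

text \<open>With \<open>m = 0\<close> the weight is the indicator of inactivity and
  \<open>c = 1\<close>, so the one-user case of \<open>nn_integral_prod_weight\<close> gives the
  probability of being inactive.\<close>

lemma emeasure_active_le: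
  "emeasure M {\<omega>\<in>space M. active n \<omega>} \<le> (\<integral>\<^sup>+\<omega>. ennreal (if T n \<omega> \<le> t then exp (- \<nu> * (t - T n \<omega>)) else 0) \<partial>M)"
proof -
  let ?A = "{\<omega>\<in>space M. active n \<omega>}" and ?th = "\<lambda>\<omega>. thinning \<nu> t 1 (T n \<omega>)"
  have "(\<integral>\<^sup>+\<omega>. ennreal (weight (\<lambda>_. 0) (T n \<omega>) (X n \<omega>) (S n \<omega>)) \<partial>M) = (\<integral>\<^sup>+\<omega>. ennreal (?th \<omega>) \<partial>M)"
    using nn_integral_prod_weight[of "\<lambda>_. 0" 0 "{n}"] by simp
  moreover have "(\<integral>\<^sup>+\<omega>. ennreal (weight (\<lambda>_. 0) (T n \<omega>) (X n \<omega>) (S n \<omega>)) \<partial>M) = (\<integral>\<^sup>+\<omega>. indicator (space M - ?A) \<omega> \<partial>M)"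
    by (intro nn_integral_cong) (auto simp: weight_def indicator_def)
  moreover have "emeasure M ?A + emeasure M (space M - ?A) = 1"
    by (subst plus_emeasure) (auto simp: Un_absorb1 emeasure_space_1)
  moreover have "(\<integral>\<^sup>+\<omega>. ennreal (1 - ?th \<omega>) \<partial>M) + (\<integral>\<^sup>+\<omega>. ennreal (?th \<omega>) \<partial>M) = 1"
    using thinning_bounds[OF \<nu>, of 1 t]
    by (subst nn_integral_add[symmetric]) (auto simp: emeasure_space_1 ennreal_plus[symmetric] simp del: ennreal_plus)
  ultimately have "emeasure M ?A + emeasure M (space M - ?A) = (\<integral>\<^sup>+\<omega>. ennreal (1 - ?th \<omega>) \<partial>M) + emeasure M (space M - ?A)"
    by simp
  then have "emeasure M ?A = (\<integral>\<^sup>+\<omega>. ennreal (1 - ?th \<omega>) \<partial>M)"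
    by (simp add: ennreal_add_left_cancel add.commute)
  then show ?thesis by (simp add: thinning_def)
qed

text \<open>Borel-Cantelli, applied separately to the users after and before the origin, whose
  activity probabilities are bounded by geometric sequences.\<close>

lemma AE_finite_active: "AE \<omega> in M. finite {n. active n \<omega>}"
proof -
  let ?q = "l / (l + \<nu>)"
  have q: "0 < ?q" "?q < 1" using l \<nu> by auto
  let ?A = "\<lambda>n. {\<omega>\<in>space M. active n \<omega>}"
  \<comment> \<open>After the origin \<open>exp (\<nu> * s)\<close> may have infinite mean at an
    arrival time \<open>s\<close>, so \<open>s \<le> t\<close> is used to reverse the sign of the
    exponent.\<close>
  have pos_le: "(if s \<le> t then exp (- \<nu> * (t - s)) else 0) \<le> exp (\<nu> * t) * exp (- \<nu> * s)" for s
  proof (cases "s \<le> t")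
    case True
    then have "0 \<le> \<nu> * (t - s)" using \<nu> by simp
    then have "exp (- \<nu> * (t - s)) \<le> exp (\<nu> * t + - \<nu> * s)" by (simp add: right_diff_distrib)
    then show ?thesis using True by (simp only: exp_add if_True)
  qed simp
  have neg_le: "(if s \<le> t then exp (- \<nu> * (t - s)) else 0) \<le> exp (- \<nu> * t) * exp (\<nu> * s)" for s
    by (simp add: right_diff_distrib exp_diff exp_minus field_simps)
  have pos: "measure M (?A (int (Suc k))) \<le> exp (\<nu> * t) * ?q ^ Suc k" for k
  proof -
    have "emeasure M (?A (int (Suc k))) \<le> (\<integral>\<^sup>+\<omega>. ennreal (exp (\<nu> * t)) * ennreal (exp (- \<nu> * T (int (Suc k)) \<omega>)) \<partial>M)"
      unfolding ennreal_mult[OF exp_ge_zero exp_ge_zero, symmetric]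
      by (intro order_trans[OF emeasure_active_le] nn_integral_mono ennreal_leI pos_le)
    also have "\<dots> = ennreal (exp (\<nu> * t) * ?q ^ Suc k)"
      using nn_integral_exp_arrivals(1)[OF \<nu>, of k] q by (simp add: nn_integral_cmult ennreal_mult del: power_Suc of_nat_Suc)
    finally show ?thesis
      using q by (simp add: emeasure_eq_measure del: power_Suc of_nat_Suc)
  qed
  have neg: "measure M (?A (- int k)) \<le> exp (- \<nu> * t) * ?q ^ Suc k" for k
  proof -
    have "emeasure M (?A (- int k)) \<le> (\<integral>\<^sup>+\<omega>. ennreal (exp (- \<nu> * t)) * ennreal (exp (\<nu> * T (- int k) \<omega>)) \<partial>M)"
      unfolding ennreal_mult[OF exp_ge_zero exp_ge_zero, symmetric]
      by (intro order_trans[OF emeasure_active_le] nn_integral_mono ennreal_leI neg_le)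
    also have "\<dots> = ennreal (exp (- \<nu> * t) * ?q ^ Suc k)"
      using nn_integral_exp_arrivals(2)[OF \<nu>, of k] q by (simp add: nn_integral_cmult ennreal_mult del: power_Suc of_nat_Suc)
    finally show ?thesis
      using q by (simp add: emeasure_eq_measure del: power_Suc of_nat_Suc)
  qed
  have sm: "summable (\<lambda>k. c * ?q ^ Suc k)" for c
  proof -
    have "summable (\<lambda>k. c * ?q * ?q ^ k)"
      using q by (intro summable_mult summable_geometric) (simp only: real_norm_def abs_of_pos)
    then show ?thesis by (simp only: power_Suc mult.assoc)
  qed
  have "AE \<omega> in M. eventually (\<lambda>k. \<omega> \<in> space M - ?A (int (Suc k))) sequentially"
    by (rule borel_cantelli_AE1[OF _ _ summable_comparison_test[OF _ sm]])
      (use pos in \<open>auto simp: emeasure_eq_measure simp del: power_Suc of_nat_Suc\<close>)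
  moreover have "AE \<omega> in M. eventually (\<lambda>k. \<omega> \<in> space M - ?A (- int k)) sequentially"
    by (rule borel_cantelli_AE1[OF _ _ summable_comparison_test[OF _ sm]])
      (use neg in \<open>auto simp: emeasure_eq_measure simp del: power_Suc\<close>)
  ultimately show ?thesis
  proof (eventually_elim)
    case (elim \<omega>)
    from eventually_conj[OF elim]
    obtain K where K: "\<And>k. k \<ge> K \<Longrightarrow> \<not> active (int (Suc k)) \<omega> \<and> \<not> active (- int k) \<omega>"
      unfolding eventually_sequentially by auto
    have "{n. active n \<omega>} \<subseteq> {- int K..int K}"
    proof safe
      fix n assume n: "T n \<omega> \<le> t" "t < T n \<omega> + S n \<omega>"
      show "n \<in> {- int K..int K}"
      proof (cases "n \<ge> 1")
        case True
        then have "n = int (Suc (nat (n - 1)))" by simp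
        with K[of "nat (n - 1)"] n have "\<not> nat (n - 1) \<ge> K" by metis
        with True show ?thesis by auto
      next
        case False
        then have "n = - int (nat (- n))" by simp
        with K[of "nat (- n)"] n have "\<not> nat (- n) \<ge> K" by metis
        with False show ?thesis by auto
      qed
    qed
    then show ?case by (rule finite_subset) simp
  qed
qed

text \<open>A law with a density has no atoms, so the independent \<open>X k\<close> almost surely
  misses the value of \<open>X n\<close>, and there are countably many pairs. Distinctness makes
  counting positions the same as counting users.\<close>

lemma AE_inj_X: "AE \<omega> in M. inj (\<lambda>n. X n \<omega>)"
proof -
  have "AE \<omega> in M. X n \<omega> \<noteq> X k \<omega>" if "n \<noteq> k" for n k
  proof -
    let ?N = "PiM {n} (\<lambda>_. borel :: 'a measure)" and ?K = "PiM {k} (\<lambda>_. borel :: 'a measure)"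
    have ind: "indep_var ?N (\<lambda>\<omega>. \<lambda>i\<in>{n}. X i \<omega>) ?K (\<lambda>\<omega>. \<lambda>i\<in>{k}. X i \<omega>)"
      by (rule indep_var_restrict[OF indep_X]) (use that in auto)
    let ?f = "\<lambda>(y::int \<Rightarrow> 'a, z::int \<Rightarrow> 'a). indicator {0} (y n - z k) :: ennreal"
    have zero: "(\<integral>\<^sup>+\<omega>'. indicator {0} (x - X k \<omega>') \<partial>M) = (0::ennreal)" for x
    proof -
      have "(\<integral>\<^sup>+\<omega>'. indicator {0} (x - X k \<omega>') \<partial>M) = (\<integral>\<^sup>+y. ennreal (f y) * indicator {0} (x - y) \<partial>lborel)"
        by (rule distributed_nn_integral[OF distr_X, symmetric]) measurable
      also have "\<dots> = (\<integral>\<^sup>+y. ennreal (f y) * indicator {x} y \<partial>lborel)"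
        by (intro nn_integral_cong) (auto simp: indicator_def)
      also have "\<dots> = 0"
        using AE_lborel_singleton[of x]
        by (subst nn_integral_0_iff_AE) (auto simp: indicator_def elim: eventually_mono)
      finally show ?thesis .
    qed
    have "(\<integral>\<^sup>+\<omega>. indicator {0} (X n \<omega> - X k \<omega>) \<partial>M) = (\<integral>\<^sup>+\<omega>. ?f (\<lambda>i\<in>{n}. X i \<omega>, \<lambda>i\<in>{k}. X i \<omega>) \<partial>M)"
      by simp
    also have "\<dots> = (\<integral>\<^sup>+\<omega>. \<integral>\<^sup>+\<omega>'. ?f (\<lambda>i\<in>{n}. X i \<omega>, \<lambda>i\<in>{k}. X i \<omega>') \<partial>M \<partial>M)"
      by (rule indep_var_nn_integral[OF ind]) (simp add: split_beta')
    also have "\<dots> = 0" by (simp add: zero)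
    finally have "AE \<omega> in M. indicator {0} (X n \<omega> - X k \<omega>) = (0::ennreal)"
      by (subst (asm) nn_integral_0_iff_AE) auto
    then show ?thesis by eventually_elim (auto simp: indicator_def split: if_splits)
  qed
  then have "AE \<omega> in M. n \<noteq> k \<longrightarrow> X n \<omega> \<noteq> X k \<omega>" for n k by (cases "n = k") auto
  then have "AE \<omega> in M. \<forall>n k. n \<noteq> k \<longrightarrow> X n \<omega> \<noteq> X k \<omega>"
    by (simp add: AE_all_countable)
  then show ?thesis by eventually_elim (auto simp: inj_def)
qed

section \<open>Counting the active positions\<close>

abbreviation "\<Phi> \<equiv> active_positions T X S t"

text \<open>
  The set \<open>\<Phi> \<omega> \<inter> A\<close> is counted without multiplicity, so a user contributes only if no earlier user
  in the enumeration sits at the same position.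
\<close>

lemma measurable_point_count [measurable]:
  assumes [measurable]: "A \<in> sets borel"
  shows "(\<lambda>\<omega>. point_count (\<Phi> \<omega>) A) \<in> borel_measurable M"
proof -
  \<comment> \<open>Along the enumeration \<open>int_decode\<close>, the set
    \<open>\<Phi> \<omega> \<inter> A\<close> is a countable disjoint union of singletons and empty
    sets, which turns the count into a series of measurable terms.\<close>
  let ?new = "\<lambda>m \<omega>. (active (int_decode m) \<omega> \<and> X (int_decode m) \<omega> \<in> A) \<and>
    (\<forall>j\<in>{..<m}. \<not> (active (int_decode j) \<omega> \<and> X (int_decode j) \<omega> = X (int_decode m) \<omega>))"
  have "point_count (\<Phi> \<omega>) A = (\<Sum>m. if ?new m \<omega> then 1 else 0)" for \<omega>
  proof -
    let ?D = "\<lambda>m. if ?new m \<omega> then {X (int_decode m) \<omega>} else {}"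
    have "\<Phi> \<omega> \<inter> A = (\<Union>m. ?D m)"
    proof (intro set_eqI iffI)
      fix x assume "x \<in> \<Phi> \<omega> \<inter> A"
      then obtain n where n: "x = X n \<omega>" "active n \<omega>" "x \<in> A"
        by (auto simp: active_positions_def)
      let ?P = "\<lambda>m. active (int_decode m) \<omega> \<and> X (int_decode m) \<omega> = x"
      have "?P (int_encode n)" using n by simp
      then obtain L where L: "?P L" and least: "\<And>j. j < L \<Longrightarrow> \<not> ?P j"
        using exists_least_iff[of ?P] by metis
      then have "?new L \<omega>"
        using n(3) by blast
      then have "x \<in> ?D L"
        using L by simp
      then show "x \<in> (\<Union>m. ?D m)" by blast
    qed (auto simp: active_positions_def split: if_splits)
    moreover have "disjoint_family ?D"
      unfolding disjoint_family_on_def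
    proof (intro ballI impI)
      fix m k :: nat assume "m \<noteq> k"
      then consider "m < k" | "k < m" by linarith
      then show "?D m \<inter> ?D k = {}" by cases (auto split: if_splits)
    qed
    ultimately have "point_count (\<Phi> \<omega>) A = (\<Sum>m. emeasure (count_space UNIV) (?D m))"
      unfolding point_count_def by (subst suminf_emeasure) auto
    also have "\<dots> = (\<Sum>m. if ?new m \<omega> then 1 else 0)"
      by (intro suminf_cong) (auto simp: emeasure_count_space_finite)
    finally show ?thesis .
  qed
  moreover have "(\<lambda>\<omega>. \<Sum>m. if ?new m \<omega> then 1 else 0 :: ennreal) \<in> borel_measurable M"
    by measurable
  ultimately show ?thesis by simp
qed

text \<open>Meaningful only where the count is finite, which holds almost surely.\<close>

definition num :: "'a set \<Rightarrow> 'w \<Rightarrow> nat" where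
  "num A \<omega> = nat \<lfloor>enn2real (point_count (\<Phi> \<omega>) A)\<rfloor>"

lemma measurable_num [measurable]:
  assumes [measurable]: "A \<in> sets borel"
  shows "num A \<in> M \<rightarrow>\<^sub>M count_space UNIV"
  unfolding num_def[abs_def] by measurable

lemma point_count_eq_card:
  assumes "finite {n. active n \<omega>}" "inj (\<lambda>n. X n \<omega>)"
  shows "point_count (\<Phi> \<omega>) A = of_nat (card {n. active n \<omega> \<and> X n \<omega> \<in> A})"
proof -
  have "\<Phi> \<omega> \<inter> A = (\<lambda>n. X n \<omega>) ` {n. active n \<omega> \<and> X n \<omega> \<in> A}"
    by (auto simp: active_positions_def)
  moreover have "finite {n. active n \<omega> \<and> X n \<omega> \<in> A}"
    by (rule finite_subset[OF _ assms(1)]) auto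
  ultimately show ?thesis
    using assms(2) by (simp add: point_count_def emeasure_count_space_finite card_image inj_on_subset)
qed

lemma AE_good: "AE \<omega> in M. finite {n. active n \<omega>} \<and> inj (\<lambda>n. X n \<omega>)"
  using AE_finite_active AE_inj_X by eventually_elim simp

lemma num_eq_card:
  assumes "finite {n. active n \<omega>} \<and> inj (\<lambda>n. X n \<omega>)"
  shows "num A \<omega> = card {n. active n \<omega> \<and> X n \<omega> \<in> A}"
  using point_count_eq_card[of \<omega> A] assms by (simp add: num_def)

lemma AE_point_count: "AE \<omega> in M. point_count (\<Phi> \<omega>) A = of_nat (num A \<omega>)"
  using AE_good by eventually_elim (simp add: point_count_eq_card num_eq_card)

text \<open>The index window \<open>{1 - n..n}\<close>, split into the arrivals after and before the origin.\<close>

lemma prod_window: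
  fixes g :: "int \<Rightarrow> 'c::comm_monoid_mult"
  shows "(\<Prod>i\<in>(\<lambda>k. int (Suc k)) ` {..<n} \<union> (\<lambda>k. - int k) ` {..<n}. g i)
    = (\<Prod>k<n. g (int (Suc k))) * (\<Prod>k<n. g (- int k))"
  by (subst prod.union_disjoint) (auto simp: prod.reindex inj_on_def)

lemma eventually_window:
  assumes "finite F"
  shows "\<forall>\<^sub>F n in sequentially. F \<subseteq> (\<lambda>k. int (Suc k)) ` {..<n} \<union> (\<lambda>k. - int k) ` {..<n}"
proof -
  have "\<forall>\<^sub>F n in sequentially. x \<in> (\<lambda>k. int (Suc k)) ` {..<n} \<union> (\<lambda>k. - int k) ` {..<n}" for x
    using eventually_gt_at_top[of "nat \<bar>x\<bar>"]
  proof eventually_elim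
    case (elim n)
    show ?case
    proof (cases "x \<ge> 1")
      case True
      then have "x = int (Suc (nat (x - 1)))" "nat (x - 1) < n" using elim by auto
      then show ?thesis by blast
    next
      case False
      then have "x = - int (nat (- x))" "nat (- x) < n" using elim by auto
      then show ?thesis by blast
    qed
  qed
  then have "\<forall>\<^sub>F n in sequentially. \<forall>x\<in>F. x \<in> (\<lambda>k. int (Suc k)) ` {..<n} \<union> (\<lambda>k. - int k) ` {..<n}"
    using assms by (intro eventually_ball_finite) auto
  then show ?thesis by eventually_elim blast
qed

text \<open>Inactive users have weight 1, so a window containing all active users yields the product
  over the active ones alone.\<close>

lemma prod_weight_eq:
  assumes "finite {n. active n \<omega>}" "{n. active n \<omega>} \<subseteq> I" "finite I"
  shows "(\<Prod>n\<in>I. weight (\<lambda>x. (if x \<in> A then z else 1) * (if x \<in> A' then z' else 1)) (T n \<omega>) (X n \<omega>) (S n \<omega>))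
    = z ^ card {n. active n \<omega> \<and> X n \<omega> \<in> A} * z' ^ card {n. active n \<omega> \<and> X n \<omega> \<in> A'}"
proof -
  let ?F = "{n. active n \<omega>}"
  have pow: "(\<Prod>n\<in>?F. if X n \<omega> \<in> C then y else 1) = y ^ card {n. active n \<omega> \<and> X n \<omega> \<in> C}" for y :: real and C
    using prod.inter_filter[OF assms(1), of "\<lambda>_. y" "\<lambda>n. X n \<omega> \<in> C"] by simp
  have "(\<Prod>n\<in>I. weight (\<lambda>x. (if x \<in> A then z else 1) * (if x \<in> A' then z' else 1)) (T n \<omega>) (X n \<omega>) (S n \<omega>))
    = (\<Prod>n\<in>?F. (if X n \<omega> \<in> A then z else 1) * (if X n \<omega> \<in> A' then z' else 1))"
    using assms by (intro prod.mono_neutral_cong_right) (auto simp: weight_def)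
  then show ?thesis
    by (simp only: prod.distrib pow)
qed

section \<open>Poisson laws and independence of the counts\<close>

text \<open>The offered load \<open>l / \<nu>\<close>, which is the mean number of active users in
  equilibrium, times the share of the position law in \<open>A\<close>. It becomes the intensity of
  \<open>A\<close>.\<close>

definition rate :: "'a set \<Rightarrow> real" where
  "rate A = l / \<nu> * \<P>(\<omega> in M. X 0 \<omega> \<in> A)"

text \<open>The expected product of weights over growing windows is evaluated in two ways: the
  thinned arrivals give an exponential limit, and dominated convergence gives the generating
  function, because almost surely the windows eventually contain all active users.\<close>

lemma num_pgf:
  assumes [measurable]: "A \<in> sets borel" "A' \<in> sets borel" and disj: "A \<inter> A' = {}"
    and z: "0 \<le> z" "z \<le> 1" "0 \<le> z'" "z' \<le> 1"
  shows "(\<integral>\<omega>. z' ^ num A' \<omega> * z ^ num A \<omega> \<partial>M) = exp (- rate A * (1 - z)) * exp (- rate A' * (1 - z'))"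
proof -
  let ?m = "\<lambda>x. (if x \<in> A then z else 1) * (if x \<in> A' then z' else 1)"
  let ?p = "\<lambda>A. \<P>(\<omega> in M. X 0 \<omega> \<in> A)"
  \<comment> \<open>By disjointness \<open>?c\<close> is the mean of
    \<open>1 - ?m (X 0 \<omega>)\<close>. Being a sum of a term in \<open>z\<close> and a term in
    \<open>z'\<close>, it splits the final exponential into two Poisson factors.\<close>
  let ?c = "(1 - z) * ?p A + (1 - z') * ?p A'"
  let ?I = "\<lambda>n. (\<lambda>k. int (Suc k)) ` {..<n} \<union> (\<lambda>k. - int k) ` {..<n}"
  let ?W = "\<lambda>n \<omega>. \<Prod>i\<in>?I n. weight ?m (T i \<omega>) (X i \<omega>) (S i \<omega>)"
  have m: "0 \<le> ?m x" "?m x \<le> 1" for x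
    using z by (auto intro: mult_le_one)
  have w: "0 \<le> weight ?m \<tau> x s" "weight ?m \<tau> x s \<le> 1" for \<tau> x s
    using m by (auto simp: weight_def)
  have Em0: "(\<integral>\<omega>. ?m (X 0 \<omega>) \<partial>M) = 1 - ?c"
  proof -
    have "(\<integral>\<omega>. ?m (X 0 \<omega>) \<partial>M) = (\<integral>\<omega>. 1 - ((1 - z) * indicator {\<omega>\<in>space M. X 0 \<omega> \<in> A} \<omega> +
        (1 - z') * indicator {\<omega>\<in>space M. X 0 \<omega> \<in> A'} \<omega>) \<partial>M)"
      using disj by (intro Bochner_Integration.integral_cong) (auto simp: indicator_def)
    also have "\<dots> = 1 - ?c"
    proof -
      have "integrable M (indicator {\<omega>\<in>space M. X 0 \<omega> \<in> C} :: _ \<Rightarrow> real)" if [measurable]: "C \<in> sets borel" for C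
        by (rule integrable_real_indicator) (auto simp: emeasure_eq_measure)
      then show ?thesis
        by (simp add: prob_space)
    qed
    finally show ?thesis .
  qed
  have Em: "(\<integral>\<^sup>+\<omega>. ennreal (?m (X n \<omega>)) \<partial>M) = ennreal (1 - ?c)" for n
  proof -
    have E: "(\<integral>\<^sup>+\<omega>. ennreal (?m (X k \<omega>)) \<partial>M) = (\<integral>\<^sup>+x. ennreal (f x) * ennreal (?m x) \<partial>lborel)" for k
      by (rule distributed_nn_integral[OF distr_X, symmetric]) measurable
    have "(\<integral>\<^sup>+\<omega>. ennreal (?m (X n \<omega>)) \<partial>M) = (\<integral>\<^sup>+\<omega>. ennreal (?m (X 0 \<omega>)) \<partial>M)"
      unfolding E ..
    also have "\<dots> = ennreal (\<integral>\<omega>. ?m (X 0 \<omega>) \<partial>M)"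
      using m by (intro nn_integral_eq_integral integrable_const_bound[of _ 1]) auto
    finally show ?thesis by (simp only: Em0)
  qed
  have c: "0 \<le> ?c" "?c \<le> 1"
  proof -
    show "0 \<le> ?c" using z by simp
    have "0 \<le> (\<integral>\<omega>. ?m (X 0 \<omega>) \<partial>M)" using m by (intro Bochner_Integration.integral_nonneg)
    then show "?c \<le> 1" unfolding Em0 by simp
  qed
  have "(\<lambda>n. \<integral>\<^sup>+\<omega>. ennreal (?W n \<omega>) \<partial>M) \<longlonglongrightarrow> ennreal (exp (- (l * ?c / \<nu>)))"
  proof -
    have "(\<integral>\<^sup>+\<omega>. ennreal (?W n \<omega>) \<partial>M) = (\<integral>\<^sup>+\<omega>. (\<Prod>i\<in>?I n. ennreal (thinning \<nu> t ?c (T i \<omega>))) \<partial>M)" for n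
      using nn_integral_prod_weight[of ?m "1 - ?c" "?I n"] m c Em w by (simp add: prod_ennreal)
    then show ?thesis
      using arrivals_thinning_tendsto[OF \<nu> c, of t] by (simp only: prod_window)
  qed
  moreover have "(\<lambda>n. \<integral>\<^sup>+\<omega>. ennreal (?W n \<omega>) \<partial>M) \<longlonglongrightarrow> (\<integral>\<^sup>+\<omega>. ennreal (z ^ num A \<omega> * z' ^ num A' \<omega>) \<partial>M)"
  proof (rule nn_integral_dominated_convergence[where w="\<lambda>_. 1"])
    show "AE \<omega> in M. ennreal (?W n \<omega>) \<le> 1" for n
      using w by (auto intro!: prod_le_1)
    show "AE \<omega> in M. (\<lambda>n. ennreal (?W n \<omega>)) \<longlonglongrightarrow> ennreal (z ^ num A \<omega> * z' ^ num A' \<omega>)"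
      using AE_good
    proof eventually_elim
      case (elim \<omega>)
      from eventually_window[of "{n. active n \<omega>}"] elim
      have "\<forall>\<^sub>F n in sequentially. {n. active n \<omega>} \<subseteq> ?I n" by simp
      then have "\<forall>\<^sub>F n in sequentially. ennreal (?W n \<omega>) = ennreal (z ^ num A \<omega> * z' ^ num A' \<omega>)"
      proof eventually_elim
        case (elim n)
        then show ?case
          using prod_weight_eq[of \<omega> "?I n" A z A' z'] \<open>finite {n. active n \<omega>} \<and> inj (\<lambda>n. X n \<omega>)\<close>
          by (simp add: num_eq_card)
      qed
      then show ?case by (rule tendsto_eventually)
    qed
  qed (auto simp: emeasure_space_1)
  ultimately have "(\<integral>\<^sup>+\<omega>. ennreal (z ^ num A \<omega> * z' ^ num A' \<omega>) \<partial>M) = ennreal (exp (- (l * ?c / \<nu>)))"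
    by (rule LIMSEQ_unique[rotated])
  then have "(\<integral>\<omega>. z ^ num A \<omega> * z' ^ num A' \<omega> \<partial>M) = exp (- (l * ?c / \<nu>))"
    using z by (subst integral_eq_nn_integral) auto
  moreover have "exp (- (l * ?c / \<nu>)) = exp (- rate A * (1 - z)) * exp (- rate A' * (1 - z'))"
    using \<nu> by (simp add: exp_add[symmetric] rate_def field_simps)
  ultimately show ?thesis
    by (simp only: mult.commute[of "z' ^ num A' _"])
qed

lemma prob_point_count:
  assumes [measurable]: "A \<in> sets borel"
  shows "\<P>(\<omega> in M. point_count (\<Phi> \<omega>) A = of_nat k) = rate A ^ k / fact k * exp (- rate A)"
proof -
  have "\<P>(\<omega> in M. point_count (\<Phi> \<omega>) A = of_nat k) = \<P>(\<omega> in M. num A \<omega> = k)"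
    using AE_point_count[of A] by (intro finite_measure_eq_AE) (auto elim!: eventually_mono)
  \<comment> \<open>The empty set serves as the second set, which reduces the marginal law to the
    joint statement.\<close>
  also have "\<dots> = rate A ^ k / fact k * exp (- rate A)"
    by (rule joint_poisson_pgf(1)[of "num A" "num {}" "rate A" "rate {}"]) (auto simp: num_pgf)
  finally show ?thesis .
qed

text \<open>Equality of the joint law with the product law is insensitive to null sets, so
  independence passes from \<open>num\<close> to the almost surely equal
  \<open>point_count\<close>.\<close>

lemma indep_point_count:
  assumes [measurable]: "A \<in> sets borel" "A' \<in> sets borel" and disj: "A \<inter> A' = {}"
  shows "indep_var borel (\<lambda>\<omega>. point_count (\<Phi> \<omega>) A) borel (\<lambda>\<omega>. point_count (\<Phi> \<omega>) A')"
proof -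
  have "indep_var (count_space UNIV) (num A) (count_space UNIV) (num A')"
    by (rule joint_poisson_pgf(2)[of "num A" "num A'" "rate A" "rate A'"]) (auto simp: num_pgf[OF assms])
  then have "indep_var borel (of_nat \<circ> num A :: _ \<Rightarrow> ennreal) borel (of_nat \<circ> num A' :: _ \<Rightarrow> ennreal)"
    by (rule indep_var_compose) auto
  moreover have "distr M borel (of_nat \<circ> num C :: _ \<Rightarrow> ennreal) = distr M borel (\<lambda>\<omega>. point_count (\<Phi> \<omega>) C)"
    if [measurable]: "C \<in> sets borel" for C
    using AE_point_count[of C] by (intro distr_cong_AE) (auto elim!: eventually_mono)
  moreover have "distr M (borel \<Otimes>\<^sub>M borel) (\<lambda>\<omega>. ((of_nat \<circ> num A) \<omega> :: ennreal, (of_nat \<circ> num A') \<omega> :: ennreal))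
      = distr M (borel \<Otimes>\<^sub>M borel) (\<lambda>\<omega>. (point_count (\<Phi> \<omega>) A, point_count (\<Phi> \<omega>) A'))"
    using AE_point_count[of A] AE_point_count[of A'] by (intro distr_cong_AE) (auto elim!: eventually_elim2)
  ultimately show ?thesis
    by (simp add: indep_var_distribution_eq)
qed

text \<open>The intensity has finite total mass \<open>rate UNIV\<close> and almost surely finitely
  many users are active, so sigma-finiteness and local finiteness follow from global
  finiteness.\<close>

theorem active_positions_poisson:
  assumes \<Lambda>: "sets \<Lambda> = sets borel" "\<And>A. A \<in> sets borel \<Longrightarrow> emeasure \<Lambda> A = ennreal (rate A)"
    and B: "\<And>n. AE \<omega> in M. X n \<omega> \<in> B"
  shows "poisson_process_on M B \<Lambda> \<Phi>"
  unfolding poisson_process_on_def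
proof (intro conjI allI impI ballI)
  have rate: "0 \<le> rate A" for A
    using l \<nu> by (simp add: rate_def)
  have measure: "measure \<Lambda> A = rate A" if "A \<in> sets borel" for A
    using rate \<Lambda>(2)[OF that] by (simp add: measure_def)
  have "space \<Lambda> = UNIV"
    using sets_eq_imp_space_eq[OF \<Lambda>(1)] by simp
  then have "finite_measure \<Lambda>"
    using \<Lambda> by (intro finite_measureI) simp
  then show "sigma_finite_measure \<Lambda>"
    by (rule finite_measure.axioms)
  have "AE \<omega> in M. \<forall>n. X n \<omega> \<in> B"
    using B by (simp add: AE_all_countable)
  with AE_finite_active show "AE \<omega> in M. \<Phi> \<omega> \<subseteq> B \<and> (\<forall>K. compact K \<longrightarrow> finite (\<Phi> \<omega> \<inter> K))"
  proof eventually_elim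
    case (elim \<omega>)
    have "\<Phi> \<omega> = (\<lambda>n. X n \<omega>) ` {n. active n \<omega>}"
      by (auto simp: active_positions_def)
    then show ?case using elim by auto
  qed
  show "emeasure \<Lambda> A < \<infinity>" if "compact A" for A
    using \<Lambda>(2)[of A] that by (simp add: compact_imp_closed)
  show "measure M {\<omega>\<in>space M. point_count (\<Phi> \<omega>) A = of_nat k} = measure \<Lambda> A ^ k / fact k * exp (- measure \<Lambda> A)"
    if "compact A" for A k
    using prob_point_count[of A k] measure[of A] that by (simp add: compact_imp_closed)
qed (use \<Lambda> in \<open>auto intro: indep_point_count prob_space_axioms\<close>)

end

section \<open>Identifying the intensity in the planar region\<close>

theorem lemma1:
  fixes M :: "'w measure"
    and B :: "(real ^ 2) set"
    and \<rho> :: "real ^ 2 \<Rightarrow> real"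
    and \<nu> lam t :: real
    and T S :: "int \<Rightarrow> 'w \<Rightarrow> real"
    and X :: "int \<Rightarrow> 'w \<Rightarrow> real ^ 2"
  assumes "prob_space M"
    and "B \<in> sets borel"
    and "\<rho> \<in> borel_measurable (restrict_space borel B)"
    and "\<And>x. x \<in> B \<Longrightarrow> 0 \<le> \<rho> x"
    and "set_integrable lborel B \<rho>"
    and "lam = (LINT x:B|lborel. \<rho> x)"
    and "0 < lam"
    and "0 < \<nu>"
    and "homogeneous_poisson_arrivals M lam T"
    and "iid_with_density M (\<lambda>x. indicator B x * \<rho> x / lam) X"
    and "iid_with_density M (exponential_density \<nu>) S"
    and "mutually_indep_families M T X S"
  shows "poisson_process_on M B
           (density lborel (\<lambda>x. ennreal (indicator B x * \<rho> x / \<nu>)))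
           (active_positions T X S t)"
proof -
  let ?f = "\<lambda>x. indicator B x * \<rho> x / lam"
  interpret prob_space M by fact
  interpret poisson_service M T lam X ?f S \<nu> t
    by unfold_locales (use assms in auto)
  have [measurable]: "B \<in> sets borel" by fact
  have [measurable]: "(\<lambda>x. indicator B x * \<rho> x) \<in> borel_measurable borel"
    using assms(2,3) by (subst (asm) borel_measurable_restrict_space_iff) auto
  have nonneg: "0 \<le> indicator B x * \<rho> x" for x
    using assms(4)[of x] by (simp add: indicator_def)
  show ?thesis
  proof (rule active_positions_poisson)
    fix A :: "(real ^ 2) set" assume [measurable]: "A \<in> sets borel"
    \<comment> \<open>The arrival rate \<open>lam\<close> cancels against the normalising factor of
      the position density, leaving \<open>\<rho> x / \<nu>\<close> on \<open>B\<close>.\<close>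
    have "ennreal (rate A) = ennreal (lam / \<nu>) * emeasure M (X 0 -` A \<inter> space M)"
      unfolding rate_def using assms(7,8)
      by (subst ennreal_mult) (auto simp: emeasure_eq_measure vimage_def Int_def conj_commute)
    also have "emeasure M (X 0 -` A \<inter> space M) = (\<integral>\<^sup>+x. ennreal (?f x) * indicator A x \<partial>lborel)"
      by (rule distributed_emeasure[OF distr_X]) simp
    also have "ennreal (lam / \<nu>) * \<dots> = (\<integral>\<^sup>+x. ennreal (lam / \<nu>) * (ennreal (?f x) * indicator A x) \<partial>lborel)"
      by (rule nn_integral_cmult[symmetric]) measurable
    also have "\<dots> = (\<integral>\<^sup>+x. ennreal (indicator B x * \<rho> x / \<nu>) * indicator A x \<partial>lborel)"
      using assms(7,8) nonneg
      by (intro nn_integral_cong) (simp add: mult.assoc[symmetric] ennreal_mult[symmetric])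
    also have "\<dots> = emeasure (density lborel (\<lambda>x. ennreal (indicator B x * \<rho> x / \<nu>))) A"
      by (rule emeasure_density[symmetric]) measurable
    finally show "emeasure (density lborel (\<lambda>x. ennreal (indicator B x * \<rho> x / \<nu>))) A = ennreal (rate A)" ..
  next
    fix n
    \<comment> \<open>The position density vanishes off \<open>B\<close>.\<close>
    have "emeasure M (X n -` (- B) \<inter> space M) = (\<integral>\<^sup>+x. ennreal (?f x) * indicator (- B) x \<partial>lborel)"
      by (rule distributed_emeasure[OF distr_X]) simp
    also have "\<dots> = (\<integral>\<^sup>+(x::real ^ 2). 0 \<partial>lborel)"
      by (intro nn_integral_cong) (auto split: split_indicator)
    finally show "AE \<omega> in M. X n \<omega> \<in> B"
      by (intro AE_I[of _ _ "X n -` (- B) \<inter> space M"]) auto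
  qed simp
qed

end
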